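(* Let $\mathcal H$ be a Hilbert space. For $i=1,2$ let $D_i$ be a self-adjoint operator on $\mathcal H$ and $B_i$ a bounded operator on $\mathcal H$ for which there is $\delta_i>0$ with $\mathrm{Re}(B_iD_iu,D_iu)\ge\delta_i\|D_iu\|^2$ for all $u\in\mathsf D(D_i)$. Assume that $\mathsf R(D_1)\subset\mathsf N(D_2)$ and $\mathsf R(D_2)\subset\mathsf N(D_1)$, and that $B_2B_1$ maps $\mathsf R(D_1)$ into $\mathsf N(D_2)$ (so that $D_2B_2B_1D_1=0$ on $\mathsf D(D_1)$). Then $B_1D_1+D_2B_2$ is a bisectorial operator on $\mathcal H$ with resolvent bounds. Furthermore, if $B_1D_1$ and $D_2B_2$ satisfy quadratic estimates, then so does $B_1D_1+D_2B_2$.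
   Context: $\mathsf D(\cdot),\mathsf N(\cdot),\mathsf R(\cdot)$ denote domain, null space and range. An operator $T$ is bisectorial with resolvent bounds if for some $\omega\in[0,\pi/2)$, with $S_\omega:=\{z\in\mathbf C:|\arg z|\le\omega\text{ or }|\arg(-z)|\le\omega\}\cup\{0\}$, one has $\sigma(T)\subset S_\omega$ and $\|(\lambda I-T)^{-1}\|\lesssim1/\mathrm{dist}(\lambda,S_\omega)$ for $\lambda\notin S_\omega$. A bisectorial operator $T$ satisfies quadratic estimates if $\int_0^\infty\|tT(I+t^2T^2)^{-1}u\|^2\,\frac{dt}t\lesssim\|u\|^2$ for all $u\in\mathcal H$. *)

theory Defs
  imports "HOL-Analysis.Analysis"
begin

section \<open>Complex Hilbert spaces\<close>

text \<open>
  The real structure of \<^class>\<open>real_inner\<close> is determined by the complex one: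
  the last assumption makes the norm the one induced by \<open>cinner\<close>, so every complex inner
  product space is an instance.
\<close>

class complex_inner = real_inner +
  fixes scaleC :: "complex \<Rightarrow> 'a \<Rightarrow> 'a" (infixr "*\<^sub>C" 75)
    and cinner :: "'a \<Rightarrow> 'a \<Rightarrow> complex"
  assumes scaleC_add_right: "c *\<^sub>C (x + y) = c *\<^sub>C x + c *\<^sub>C y"
    and scaleC_add_left: "(c + d) *\<^sub>C x = c *\<^sub>C x + d *\<^sub>C x"
    and scaleC_scaleC: "c *\<^sub>C d *\<^sub>C x = (c * d) *\<^sub>C x"
    and scaleC_of_real: "complex_of_real r *\<^sub>C x = r *\<^sub>R x"
    and cinner_add_left: "cinner (x + y) z = cinner x z + cinner y z"
    and cinner_scaleC_left: "cinner (c *\<^sub>C x) y = c * cinner x y"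
    and cinner_commute: "cinner x y = cnj (cinner y x)"
    and Re_cinner: "Re (cinner x y) = inner x y"

class complex_hilbert_space = complex_inner + complete_space

definition bounded_clinear :: "('a::complex_inner \<Rightarrow> 'a) \<Rightarrow> bool" where
  "bounded_clinear B \<longleftrightarrow> bounded_linear B \<and> (\<forall>c u. B (c *\<^sub>C u) = c *\<^sub>C B u)"


section \<open>Unbounded operators\<close>

text \<open>
  An operator is identified with its graph, a set of pairs \<open>(u, T u)\<close>. Its domain, range and
  (possibly partial) inverse are \<^const>\<open>Domain\<close>, \<^const>\<open>Range\<close> and \<^const>\<open>converse\<close>.
\<close>

type_synonym 'a operator = "('a \<times> 'a) set"

definition linear_operator :: "'a::complex_inner operator \<Rightarrow> bool" where
  "linear_operator T \<longleftrightarrow>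
     single_valued T \<and> (0, 0) \<in> T \<and>
     (\<forall>u v u' v'. (u, v) \<in> T \<longrightarrow> (u', v') \<in> T \<longrightarrow> (u + u', v + v') \<in> T) \<and>
     (\<forall>c u v. (u, v) \<in> T \<longrightarrow> (c *\<^sub>C u, c *\<^sub>C v) \<in> T)"

text \<open>\<open>app T u\<close> is meaningful only for \<open>u\<close> in the domain of a single-valued \<open>T\<close>.\<close>

definition app :: "'a operator \<Rightarrow> 'a \<Rightarrow> 'a" where
  "app T u = (THE v. (u, v) \<in> T)"

definition null_space :: "'a::zero operator \<Rightarrow> 'a set" where
  "null_space T = {u. (u, 0) \<in> T}"

definition op_of :: "('a \<Rightarrow> 'a) \<Rightarrow> 'a operator" where
  "op_of f = {(u, f u) | u. True}"

definition op_add :: "'a::plus operator \<Rightarrow> 'a operator \<Rightarrow> 'a operator" where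
  "op_add S T = {(u, v + w) | u v w. (u, v) \<in> S \<and> (u, w) \<in> T}"

definition op_scale :: "complex \<Rightarrow> 'a::complex_inner operator \<Rightarrow> 'a operator" where
  "op_scale c T = {(u, c *\<^sub>C v) | u v. (u, v) \<in> T}"

text \<open>\<open>op_comp S T\<close> is \<open>S T\<close>, with domain those \<open>u\<close> in the domain of \<open>T\<close> for which
  \<open>T u\<close> is in the domain of \<open>S\<close>; relational composition has the opposite order.\<close>

definition op_comp :: "'a operator \<Rightarrow> 'a operator \<Rightarrow> 'a operator" where
  "op_comp S T = T O S"

definition adjoint_op :: "'a::complex_inner operator \<Rightarrow> 'a operator" where
  "adjoint_op T = {(v, w). \<forall>u Tu. (u, Tu) \<in> T \<longrightarrow> cinner Tu v = cinner u w}"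

definition self_adjoint :: "'a::complex_inner operator \<Rightarrow> bool" where
  "self_adjoint T \<longleftrightarrow> linear_operator T \<and> closure (Domain T) = UNIV \<and> adjoint_op T = T"


section \<open>Spectrum and bisectorial operators\<close>

text \<open>\<open>resolvent T z\<close> is the inverse of \<open>z I - T\<close>. A point \<open>z\<close> is in the resolvent set if
  this inverse is a bounded operator defined on the whole space.\<close>

definition resolvent :: "'a::complex_inner operator \<Rightarrow> complex \<Rightarrow> 'a operator" where
  "resolvent T z = (op_add (op_of (\<lambda>u. z *\<^sub>C u)) (op_scale (-1) T))\<inverse>"

definition resolvent_set :: "'a::complex_inner operator \<Rightarrow> complex set" where
  "resolvent_set T = {z. \<exists>R. bounded_clinear R \<and> resolvent T z = op_of R}"

definition spectrum :: "'a::complex_inner operator \<Rightarrow> complex set" where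
  "spectrum T = - resolvent_set T"

definition bisector :: "real \<Rightarrow> complex set" where
  "bisector \<omega> = {z. \<bar>Arg z\<bar> \<le> \<omega> \<or> \<bar>Arg (- z)\<bar> \<le> \<omega>} \<union> {0}"

text \<open>Closedness of \<open>T\<close> is not required separately: it follows from the existence of a
  point in the resolvent set.\<close>

definition bisectorial :: "'a::complex_hilbert_space operator \<Rightarrow> bool" where
  "bisectorial T \<longleftrightarrow> linear_operator T \<and>
     (\<exists>\<omega>. 0 \<le> \<omega> \<and> \<omega> < pi / 2 \<and> spectrum T \<subseteq> bisector \<omega> \<and>
       (\<exists>C. \<forall>z. z \<notin> bisector \<omega> \<longrightarrow>
          onorm (app (resolvent T z)) \<le> C / infdist z (bisector \<omega>)))"

text \<open>\<open>psi_op T t\<close> is \<open>t T (I + t\<^sup>2 T\<^sup>2)\<inverse>\<close>. For bisectorial \<open>T\<close> and \<open>t > 0\<close> it is defined on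
  the whole space, because \<open>\<plusminus> \<i> / t\<close> are in the resolvent set.\<close>

definition psi_op :: "'a::complex_inner operator \<Rightarrow> real \<Rightarrow> 'a operator" where
  "psi_op T t =
     op_comp (op_scale (of_real t) T)
       ((op_add (op_of id) (op_scale (of_real (t\<^sup>2)) (op_comp T T)))\<inverse>)"

text \<open>This is intended for bisectorial \<open>T\<close> only.\<close>

definition quadratic_estimates :: "'a::complex_hilbert_space operator \<Rightarrow> bool" where
  "quadratic_estimates T \<longleftrightarrow>
     (\<exists>C. \<forall>u. (\<integral>\<^sup>+ t \<in> {0<..}. ennreal ((norm (app (psi_op T t) u))\<^sup>2 / t) \<partial>lborel)
        \<le> ennreal (C * (norm u)\<^sup>2))"

end

theory Submission
  imports Defs
begin

text \<open>
  Write \<open>T\<^sub>1 = B\<^sub>1 D\<^sub>1\<close> and \<open>T\<^sub>2 = D\<^sub>2 B\<^sub>2\<close>. The hypotheses on ranges and null spaces say that the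
  two operators annihilate each other: the range of \<open>T\<^sub>2\<close> lies in the null space of \<open>T\<^sub>1\<close>, because
  \<open>D\<^sub>1\<close> vanishes on the range of \<open>D\<^sub>2\<close>, and the range of \<open>T\<^sub>1\<close> lies in the null space of \<open>T\<^sub>2\<close>, because
  \<open>D\<^sub>2 B\<^sub>2 B\<^sub>1 D\<^sub>1 = 0\<close>. For such a pair the resolvent of the sum is explicit,
  \<open>(z - T\<^sub>1 - T\<^sub>2)\<inverse> = (z - T\<^sub>1)\<inverse> + (z - T\<^sub>2)\<inverse> - 1/z\<close> (\<open>has_resolvent_sum\<close>), so resolvent bounds
  for \<open>T\<^sub>1\<close> and \<open>T\<^sub>2\<close> give resolvent bounds for the sum. The operator \<open>t T (1 + t\<^sup>2 T\<^sup>2)\<inverse>\<close> is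
  \<open>-1/(2t)\<close> times the sum of the resolvents at \<open>\<i>/t\<close> and \<open>-\<i>/t\<close> (\<open>psi_op_eq_resolvents\<close>). In this sum
  the two terms \<open>1/z\<close> cancel, so this operator is additive in the pair (\<open>psi_op_sum\<close>) and the
  quadratic estimates add up.

  There remains the bisectoriality of \<open>B D\<close> and \<open>D B\<close> for one self-adjoint \<open>D\<close> and one bounded
  \<open>B\<close> accretive on the range of \<open>D\<close>. Let \<open>P\<close> be the orthogonal projection onto the closure of the
  range of \<open>D\<close>; its complement \<open>1 - P\<close> projects onto the null space. Then \<open>A = P B P + (1 - P)\<close> is
  accretive on the whole space, hence invertible, with an inverse \<open>G\<close> that is again accretive.
  Both \<open>B D\<close> and \<open>D B\<close> are similar to \<open>A D\<close> through bounded invertible operators: the parts of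
  \<open>B\<close> that \<open>A\<close> leaves out are block triangular with respect to \<open>P\<close>, and a block triangular change
  of variables removes them.

  For \<open>A D\<close>, the equation \<open>(z - A D) u = f\<close> reads \<open>(z G - D) u = G f\<close>, and \<open>z G - D\<close> is
  controlled by its imaginary part (\<open>pencil_inverse\<close>). Since \<open>(D u, u)\<close> is real,
  \<open>Im ((z G - D) u, u) = Im (z (G u, u))\<close>. The number \<open>(G u, u)\<close> stays in a sector of half-angle
  \<open>\<omega> < \<pi>/2\<close>, so this imaginary part is at least the distance from \<open>z\<close> to the bisector times
  \<open>Re (G u, u)\<close> (\<open>infdist_bisector_le_Im\<close>). This is a lower bound for \<open>z G - D\<close>, and
  the same bound excludes vectors orthogonal to its range.
\<close>

section \<open>Complex inner product spaces\<close>

interpretation cvs: vector_space "scaleC :: complex \<Rightarrow> 'a \<Rightarrow> 'a::complex_inner"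
proof
  show "1 *\<^sub>C x = x" for x :: 'a
    using scaleC_of_real[of 1 x] by simp
qed (simp_all add: scaleC_add_right scaleC_add_left scaleC_scaleC)

lemma cinner_scaleC_right: "cinner x (c *\<^sub>C y) = cnj c * cinner x y"
  by (metis cinner_commute cinner_scaleC_left complex_cnj_cnj complex_cnj_mult)

lemma cinner_diff_left: "cinner (x - y) z = cinner x z - cinner y z"
  using cinner_add_left[of "x - y" y z] by simp

lemma Im_cinner: "Im (cinner x y) = inner x (\<i> *\<^sub>C y)"
  using Re_cinner[of x "\<i> *\<^sub>C y"] by (simp add: cinner_scaleC_right)

lemma cinner_self: "cinner x x = complex_of_real ((norm x)\<^sup>2)"
  using Re_cinner[of x x] cinner_commute[of x x]
  by (simp add: complex_eq_iff power2_norm_eq_inner)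

lemma inner_scaleC_left: "inner (c *\<^sub>C x) y = inner x (cnj c *\<^sub>C y)"
  using Re_cinner[of "c *\<^sub>C x" y] Re_cinner[of x "cnj c *\<^sub>C y"]
  by (simp add: cinner_scaleC_left cinner_scaleC_right)

lemma norm_scaleC [simp]: "norm (c *\<^sub>C x) = cmod c * norm (x::'a::complex_inner)"
proof -
  have "complex_of_real ((norm (c *\<^sub>C x))\<^sup>2) = complex_of_real ((cmod c * norm x)\<^sup>2)"
    by (simp only: cinner_self[symmetric] cinner_scaleC_left cinner_scaleC_right
        power_mult_distrib of_real_mult complex_norm_square) (simp add: ac_simps)
  then have "(norm (c *\<^sub>C x))\<^sup>2 = (cmod c * norm x)\<^sup>2"
    using of_real_eq_iff by blast
  then show ?thesis
    by simp
qed

lemma abs_Im_cinner_le: "\<bar>Im (cinner x y)\<bar> \<le> norm x * norm y"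
  using Cauchy_Schwarz_ineq2[of x "\<i> *\<^sub>C y"] by (simp add: Im_cinner)

lemma bounded_linear_scaleC: "bounded_linear (\<lambda>x::'a::complex_inner. c *\<^sub>C x)"
proof (rule bounded_linear_intro[where K = "cmod c"])
  show "c *\<^sub>C (r *\<^sub>R x) = r *\<^sub>R c *\<^sub>C x" for r and x :: 'a
    by (simp add: scaleC_of_real[symmetric] mult.commute)
qed (simp_all add: scaleC_add_right)

lemma bounded_clinearI:
  assumes "\<And>x y. f (x + y) = f x + f y" and "\<And>c x. f (c *\<^sub>C x) = c *\<^sub>C f x"
    and "\<And>x. norm (f x) \<le> K * norm x"
  shows "bounded_clinear f"
  unfolding bounded_clinear_def
proof
  have "f (r *\<^sub>R x) = r *\<^sub>R f x" for r x
    by (metis assms(2) scaleC_of_real)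
  then show "bounded_linear f"
    by (intro bounded_linear_intro[where K = K]) (use assms in \<open>auto simp: mult.commute\<close>)
qed (use assms in auto)

lemma bounded_clinear_linear: "bounded_clinear f \<Longrightarrow> bounded_linear f"
  by (simp add: bounded_clinear_def)

lemma
  assumes "bounded_clinear f"
  shows bounded_clinear_add: "f (x + y) = f x + f y"
    and bounded_clinear_diff: "f (x - y) = f x - f y"
    and bounded_clinear_zero: "f 0 = 0"
    and bounded_clinear_scaleC: "f (c *\<^sub>C x) = c *\<^sub>C f x"
  using assms bounded_linear.linear[of f]
  by (auto simp: bounded_clinear_def linear_add linear_diff linear_0)

lemmas clinear_simps =
  bounded_clinear_add bounded_clinear_diff bounded_clinear_zero bounded_clinear_scaleC

lemma bounded_clinear_bound:
  assumes "bounded_clinear f"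
  obtains K where "K > 0" and "\<And>x. norm (f x) \<le> K * norm x"
  using bounded_linear.pos_bounded[OF bounded_clinear_linear[OF assms]]
  by (auto simp: mult.commute)

lemma bounded_clinear_id: "bounded_clinear (\<lambda>x. x)"
  by (simp add: bounded_clinear_def bounded_linear_ident)

lemma bounded_clinear_compose:
  "bounded_clinear f \<Longrightarrow> bounded_clinear g \<Longrightarrow> bounded_clinear (\<lambda>x. f (g x))"
  by (simp add: bounded_clinear_def bounded_linear_compose)

lemma bounded_clinear_plus:
  "bounded_clinear f \<Longrightarrow> bounded_clinear g \<Longrightarrow> bounded_clinear (\<lambda>x. f x + g x)"
  by (simp add: bounded_clinear_def bounded_linear_add scaleC_add_right)

lemma bounded_clinear_minus:
  "bounded_clinear f \<Longrightarrow> bounded_clinear g \<Longrightarrow> bounded_clinear (\<lambda>x. f x - g x)"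
  by (simp add: bounded_clinear_def bounded_linear_sub cvs.scale_right_diff_distrib)

lemma bounded_clinear_scale:
  "bounded_clinear f \<Longrightarrow> bounded_clinear (\<lambda>x. c *\<^sub>C f x)"
  by (simp add: bounded_clinear_def mult.commute
      bounded_linear_compose[OF bounded_linear_scaleC, of f c])

section \<open>Orthogonal projections and the Riesz representation\<close>

text \<open>
  The parallelogram law, applied to midpoints in \<open>S\<close>, makes every minimizing sequence for the
  distance to \<open>S\<close> a Cauchy sequence. At the minimizer, moving by a multiple of \<open>s \<in> S\<close> cannot decrease
  the distance, which forces orthogonality.
\<close>

lemma orthogonal_projection_exists:
  fixes S :: "'a::{real_inner, complete_space} set"
  assumes S: "closed S" "subspace S"
  shows "\<exists>y\<in>S. \<forall>s\<in>S. inner (x - y) s = 0"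
proof -
  define m where "m = (INF s\<in>S. (norm (x - s))\<^sup>2)"
  have bdd: "bdd_below ((\<lambda>s. (norm (x - s))\<^sup>2) ` S)"
    by (rule bdd_belowI[of _ 0]) auto
  have ne: "S \<noteq> {}"
    using S(2) subspace_0 by auto
  have m_le: "m \<le> (norm (x - s))\<^sup>2" if "s \<in> S" for s
    unfolding m_def using bdd that by (rule cINF_lower)
  have "\<exists>s\<in>S. (norm (x - s))\<^sup>2 < m + inverse (real (Suc n))" for n
    using cINF_less_iff[OF ne bdd, of "m + inverse (real (Suc n))"] unfolding m_def by simp
  then obtain y where y: "\<And>n. y n \<in> S"
    and y_lt: "\<And>n. (norm (x - y n))\<^sup>2 < m + inverse (real (Suc n))"
    by metis
  have close: "(norm (y i - y j))\<^sup>2 \<le> 2 * inverse (real (Suc i)) + 2 * inverse (real (Suc j))" for i j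
  proof -
    have mid: "(1/2) *\<^sub>R (y i + y j) \<in> S"
      using S(2) y by (intro subspace_scale subspace_add)
    have "(norm (y i - y j))\<^sup>2 = 2 * (norm (x - y i))\<^sup>2 + 2 * (norm (x - y j))\<^sup>2
        - 4 * (norm (x - (1/2) *\<^sub>R (y i + y j)))\<^sup>2"
      unfolding power2_norm_eq_inner
      by (simp add: inner_diff inner_add inner_commute algebra_simps)
    then show ?thesis
      using m_le[OF mid] y_lt[of i] y_lt[of j] by linarith
  qed
  have "Cauchy y"
  proof (rule metric_CauchyI)
    fix e :: real
    assume "e > 0"
    then obtain N where N: "inverse (real (Suc N)) < e\<^sup>2 / 4"
      using reals_Archimedean[of "e\<^sup>2 / 4"] by auto
    show "\<exists>M. \<forall>i\<ge>M. \<forall>j\<ge>M. dist (y i) (y j) < e"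
    proof (intro exI[of _ N] allI impI)
      fix i j
      assume ij: "N \<le> i" "N \<le> j"
      have "inverse (real (Suc i)) \<le> inverse (real (Suc N))"
        "inverse (real (Suc j)) \<le> inverse (real (Suc N))"
        using ij by (auto intro!: le_imp_inverse_le)
      then have "(norm (y i - y j))\<^sup>2 < e\<^sup>2"
        using close[of i j] N by linarith
      then show "dist (y i) (y j) < e"
        using \<open>e > 0\<close> by (simp add: dist_norm power2_less_imp_less)
    qed
  qed
  then obtain p where p: "y \<longlonglongrightarrow> p"
    using Cauchy_convergent convergent_def by blast
  have pS: "p \<in> S"
    using closed_sequentially[OF S(1)] y p by blast
  have "(norm (x - p))\<^sup>2 \<le> m + 0"
  proof (rule LIMSEQ_le)
    show "(\<lambda>n. (norm (x - y n))\<^sup>2) \<longlonglongrightarrow> (norm (x - p))\<^sup>2"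
      by (intro tendsto_intros p)
    show "(\<lambda>n. m + inverse (real (Suc n))) \<longlonglongrightarrow> m + 0"
      by (intro tendsto_intros LIMSEQ_inverse_real_of_nat)
    show "\<exists>N. \<forall>n\<ge>N. (norm (x - y n))\<^sup>2 \<le> m + inverse (real (Suc n))"
      using y_lt less_imp_le by blast
  qed
  then have p_min: "(norm (x - p))\<^sup>2 \<le> (norm (x - s))\<^sup>2" if "s \<in> S" for s
    using m_le[OF that] by linarith
  have "inner (x - p) s = 0" if "s \<in> S" for s
  proof (cases "s = 0")
    case False
    \<comment> \<open>the multiple of \<open>s\<close> that minimizes the distance along the line through \<open>p\<close>\<close>
    define t where "t = inner (x - p) s / (norm s)\<^sup>2"
    have "(norm (x - p))\<^sup>2 \<le> (norm (x - (p + t *\<^sub>R s)))\<^sup>2"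
      using p_min that S(2) pS by (simp add: subspace_add subspace_scale)
    also have "\<dots> = (norm (x - p))\<^sup>2 - 2 * t * inner (x - p) s + t\<^sup>2 * (norm s)\<^sup>2"
      unfolding power2_norm_eq_inner
      by (simp add: inner_diff inner_add inner_commute algebra_simps power2_eq_square)
    also have "\<dots> = (norm (x - p))\<^sup>2 - (inner (x - p) s)\<^sup>2 / (norm s)\<^sup>2"
      using False by (simp add: t_def power2_eq_square field_simps)
    finally have "(inner (x - p) s)\<^sup>2 / (norm s)\<^sup>2 \<le> 0"
      by simp
    then show ?thesis
      using False by (simp add: divide_le_0_iff)
  qed simp
  then show ?thesis
    using pS by blast
qed

lemma subspace_scaleC_I:
  fixes S :: "'a::complex_inner set"
  assumes "0 \<in> S" "\<And>x y. x \<in> S \<Longrightarrow> y \<in> S \<Longrightarrow> x + y \<in> S" "\<And>c x. x \<in> S \<Longrightarrow> c *\<^sub>C x \<in> S"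
  shows "subspace S"
  unfolding subspace_def using assms by (metis scaleC_of_real)

lemma orthogonal_projection_clinear:
  fixes S :: "'a::complex_hilbert_space set"
  assumes S: "closed S" "subspace S" and SC: "\<And>c x. x \<in> S \<Longrightarrow> c *\<^sub>C x \<in> S"
  obtains P where "bounded_clinear P" "\<forall>x. P x \<in> S" "\<forall>x. \<forall>s\<in>S. inner (x - P x) s = 0"
    "\<forall>x\<in>S. P x = x"
proof -
  obtain P where PS: "\<And>x. P x \<in> S" and P: "\<And>x s. s \<in> S \<Longrightarrow> inner (x - P x) s = 0"
    using orthogonal_projection_exists[OF S] by metis
  have uniq: "P x = y" if y: "y \<in> S" and o: "\<And>s. s \<in> S \<Longrightarrow> inner (x - y) s = 0" for x y
  proof -
    have d: "P x - y \<in> S"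
      using S(2) PS y by (intro subspace_diff)
    have "inner (P x - y) (P x - y) = inner (x - y) (P x - y) - inner (x - P x) (P x - y)"
      by (simp add: inner_diff_left)
    also have "\<dots> = 0"
      using P[OF d, of x] o[OF d] by simp
    finally show ?thesis
      by simp
  qed
  have "bounded_clinear P"
  proof (rule bounded_clinearI[where K = 1])
    show "P (x + y) = P x + P y" for x y
    proof (rule uniq)
      show "P x + P y \<in> S"
        using S(2) PS by (intro subspace_add)
      show "inner (x + y - (P x + P y)) s = 0" if "s \<in> S" for s
        using P[OF that, of x] P[OF that, of y] by (simp add: inner_diff_left inner_add_left)
    qed
    show "P (c *\<^sub>C x) = c *\<^sub>C P x" for c x
    proof (rule uniq)
      show "inner (c *\<^sub>C x - c *\<^sub>C P x) s = 0" if "s \<in> S" for s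
        using P[OF SC[OF that], of x "cnj c"]
        by (simp add: inner_scaleC_left cvs.scale_right_diff_distrib[symmetric])
    qed (use SC PS in auto)
    show "norm (P x) \<le> 1 * norm x" for x
    proof -
      have "(norm x)\<^sup>2 = (norm (P x))\<^sup>2 + (norm (x - P x))\<^sup>2"
        using P[OF PS, of x x] unfolding power2_norm_eq_inner
        by (simp add: inner_diff inner_commute)
      then show ?thesis
        by (simp add: power2_le_imp_le)
    qed
  qed
  moreover have "P x = x" if "x \<in> S" for x
    using that by (intro uniq) auto
  ultimately show ?thesis
    using that PS P by blast
qed

text \<open>
  The kernel of a nonzero functional has a nonzero normal vector \<open>y\<close>, and the functional is
  determined by its kernel and its value at \<open>y\<close>. The real form suffices below: a complex identity
  follows from its real part, by complex linearity of the operators involved.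
\<close>

lemma riesz_representation:
  fixes \<phi> :: "'a::{real_inner, complete_space} \<Rightarrow> real"
  assumes "bounded_linear \<phi>"
  shows "\<exists>w. \<forall>u. \<phi> u = inner u w"
proof (cases "\<forall>u. \<phi> u = 0")
  case True
  then show ?thesis
    by (intro exI[of _ 0]) simp
next
  case False
  then obtain x where x: "\<phi> x \<noteq> 0"
    by auto
  interpret bounded_linear \<phi>
    by fact
  define S where "S = {u. \<phi> u = 0}"
  have "closed S"
    unfolding S_def by (intro closed_Collect_eq continuous_intros linear_continuous_on assms)
  moreover have "subspace S"
    by (auto simp: S_def subspace_def add scaleR)
  ultimately obtain p where p: "p \<in> S" "\<And>s. s \<in> S \<Longrightarrow> inner (x - p) s = 0"
    using orthogonal_projection_exists by blast
  define y where "y = x - p"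
  have y: "\<phi> y \<noteq> 0"
    using x p(1) by (simp add: y_def S_def diff)
  then have ny: "norm y \<noteq> 0"
    by auto
  have "\<phi> u = inner u ((\<phi> y / (norm y)\<^sup>2) *\<^sub>R y)" for u
  proof -
    have "u - (\<phi> u / \<phi> y) *\<^sub>R y \<in> S"
      using y by (simp add: S_def diff scaleR)
    then have "inner y (u - (\<phi> u / \<phi> y) *\<^sub>R y) = 0"
      using p(2) by (simp add: y_def)
    then have "inner u y = \<phi> u / \<phi> y * (norm y)\<^sup>2"
      by (simp add: inner_diff power2_norm_eq_inner inner_commute)
    then show ?thesis
      using y ny by (simp add: field_simps)
  qed
  then show ?thesis
    by blast
qed


section \<open>Linear graphs and coercivity\<close>

lemma
  assumes "linear_operator T"
  shows linear_operator_zero: "(0, 0) \<in> T"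
    and linear_operator_add: "(u, v) \<in> T \<Longrightarrow> (u', v') \<in> T \<Longrightarrow> (u + u', v + v') \<in> T"
    and linear_operator_scale: "(u, v) \<in> T \<Longrightarrow> (c *\<^sub>C u, c *\<^sub>C v) \<in> T"
    and linear_operator_unique: "(u, v) \<in> T \<Longrightarrow> (u, w) \<in> T \<Longrightarrow> v = w"
proof -
  show "(0, 0) \<in> T"
    using assms by (simp add: linear_operator_def)
  show "(u, v) \<in> T \<Longrightarrow> (u', v') \<in> T \<Longrightarrow> (u + u', v + v') \<in> T"
    using assms by (simp add: linear_operator_def)
  show "(u, v) \<in> T \<Longrightarrow> (c *\<^sub>C u, c *\<^sub>C v) \<in> T"
    using assms by (simp add: linear_operator_def)
  have "single_valued T"
    using assms by (simp add: linear_operator_def)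
  then show "(u, v) \<in> T \<Longrightarrow> (u, w) \<in> T \<Longrightarrow> v = w"
    by (rule single_valuedD)
qed

lemma op_addI: "(u, a) \<in> S \<Longrightarrow> (u, b) \<in> T \<Longrightarrow> v = a + b \<Longrightarrow> (u, v) \<in> op_add S T"
  by (auto simp: op_add_def)

lemma op_addE:
  assumes "(u, v) \<in> op_add S T"
  obtains a b where "(u, a) \<in> S" "(u, b) \<in> T" "v = a + b"
  using assms by (auto simp: op_add_def)

lemma linear_operator_diff:
  assumes "linear_operator T" "(u, v) \<in> T" "(u', v') \<in> T"
  shows "(u - u', v - v') \<in> T"
  using linear_operator_add[OF assms(1,2) linear_operator_scale[OF assms(1,3), of "-1"]] by simp

lemma linear_operator_op_add:
  assumes S: "linear_operator S" and T: "linear_operator T"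
  shows "linear_operator (op_add S T)"
  unfolding linear_operator_def
proof (intro conjI allI impI)
  show "single_valued (op_add S T)"
    by (rule single_valuedI)
      (metis op_addE linear_operator_unique[OF S] linear_operator_unique[OF T])
  show "(0, 0) \<in> op_add S T"
    by (rule op_addI[OF linear_operator_zero[OF S] linear_operator_zero[OF T]]) simp
  show "(u + u', v + v') \<in> op_add S T"
    if uv: "(u, v) \<in> op_add S T" "(u', v') \<in> op_add S T" for u v u' v'
  proof -
    obtain a b where 1: "(u, a) \<in> S" "(u, b) \<in> T" "v = a + b"
      using uv(1) by (rule op_addE)
    obtain a' b' where 2: "(u', a') \<in> S" "(u', b') \<in> T" "v' = a' + b'"
      using uv(2) by (rule op_addE)
    show ?thesis
      by (rule op_addI[OF linear_operator_add[OF S 1(1) 2(1)] linear_operator_add[OF T 1(2) 2(2)]])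
        (simp add: 1(3) 2(3))
  qed
  show "(c *\<^sub>C u, c *\<^sub>C v) \<in> op_add S T" if uv: "(u, v) \<in> op_add S T" for c u v
  proof -
    obtain a b where 1: "(u, a) \<in> S" "(u, b) \<in> T" "v = a + b"
      using uv by (rule op_addE)
    show ?thesis
      by (rule op_addI[OF linear_operator_scale[OF S 1(1)] linear_operator_scale[OF T 1(2)]])
        (simp add: 1(3) scaleC_add_right)
  qed
qed

text \<open>
  The lower bound and closedness make the range closed; a closed range without nonzero orthogonal
  vectors is the whole space. The graph formulation serves both for bounded operators and for
  the unbounded pencils \<open>z G - D\<close>.
\<close>

lemma coercive_graph_inverse:
  fixes L :: "'a::complex_hilbert_space operator"
  assumes L: "linear_operator L" "closed L"
    and below: "\<And>u f. (u, f) \<in> L \<Longrightarrow> norm u \<le> k * norm f"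
    and dense: "\<And>y. (\<And>u f. (u, f) \<in> L \<Longrightarrow> inner f y = 0) \<Longrightarrow> y = 0"
  obtains R where "bounded_clinear R" "\<And>f. norm (R f) \<le> k * norm f"
    "\<And>u f. (u, f) \<in> L \<longleftrightarrow> u = R f"
proof -
  note Ladd = linear_operator_add[OF L(1)] and Lsc = linear_operator_scale[OF L(1)]
    and Ldiff = linear_operator_diff[OF L(1)] and L0 = linear_operator_zero[OF L(1)]
  have sub: "subspace (Range L)"
    by (rule subspace_scaleC_I) (use L0 Ladd Lsc in blast)+
  have "closed (Range L)"
    unfolding closed_sequential_limits
  proof (intro allI impI, elim conjE)
    fix f l
    assume f: "\<forall>n. f n \<in> Range L" and lim: "f \<longlonglongrightarrow> l"
    then have "\<forall>n. \<exists>u. (u, f n) \<in> L"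
      by blast
    then obtain u where u: "\<And>n. (u n, f n) \<in> L"
      by metis
    have "Cauchy u"
    proof (rule metric_CauchyI)
      fix e :: real
      assume e: "e > 0"
      have "Cauchy f"
        using lim LIMSEQ_imp_Cauchy by blast
      then obtain N where N: "\<And>i j. i \<ge> N \<Longrightarrow> j \<ge> N \<Longrightarrow> dist (f i) (f j) < e / (\<bar>k\<bar> + 1)"
        using metric_CauchyD[of f "e / (\<bar>k\<bar> + 1)"] e by auto
      have "dist (u i) (u j) < e" if "i \<ge> N" "j \<ge> N" for i j
      proof -
        have "dist (u i) (u j) \<le> k * norm (f i - f j)"
          using below[OF Ldiff[OF u u]] by (simp add: dist_norm)
        also have "\<dots> \<le> (\<bar>k\<bar> + 1) * norm (f i - f j)"
          by (intro mult_right_mono) auto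
        also have "\<dots> < e"
          using N[OF that] by (simp add: dist_norm field_simps)
        finally show ?thesis .
      qed
      then show "\<exists>M. \<forall>i\<ge>M. \<forall>j\<ge>M. dist (u i) (u j) < e"
        by blast
    qed
    then obtain v where "u \<longlonglongrightarrow> v"
      using Cauchy_convergent convergent_def by blast
    then have "(\<lambda>n. (u n, f n)) \<longlonglongrightarrow> (v, l)"
      using lim by (intro tendsto_intros)
    then have "(v, l) \<in> L"
      using closed_sequentially[OF L(2), of "\<lambda>n. (u n, f n)"] u by blast
    then show "l \<in> Range L"
      by blast
  qed
  have surj: "\<exists>u. (u, f) \<in> L" for f
  proof -
    obtain p where p: "p \<in> Range L" "\<And>s. s \<in> Range L \<Longrightarrow> inner (f - p) s = 0"
      using orthogonal_projection_exists[OF \<open>closed (Range L)\<close> sub] by metis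
    have "f - p = 0"
      by (rule dense) (metis Range.intros inner_commute p(2))
    then show ?thesis
      using p(1) by auto
  qed
  then obtain R where R: "\<And>f. (R f, f) \<in> L"
    by metis
  have inj: "u = R f" if "(u, f) \<in> L" for u f
    using below[OF Ldiff[OF that R[of f]]] by simp
  have "bounded_clinear R"
  proof (rule bounded_clinearI[where K = k])
    show "R (x + y) = R x + R y" for x y
      using inj[OF Ladd[OF R R]] by metis
    show "R (c *\<^sub>C x) = c *\<^sub>C R x" for c x
      using inj[OF Lsc[OF R]] by metis
  qed (use below R in blast)
  then show ?thesis
    using that below R inj by metis
qed

text \<open>
  The Lax--Milgram theorem. Accretivity passes to the inverse because \<open>(G v, v) = (w, A w)\<close> for
  \<open>w = G v\<close>, while the norm of \<open>v = A w\<close> is at most a multiple of that of \<open>w\<close>.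
\<close>

lemma accretive_inverse:
  fixes A :: "'a::complex_hilbert_space \<Rightarrow> 'a"
  assumes A: "bounded_clinear A" and c: "c > 0"
    and acc: "\<And>u. inner (A u) u \<ge> c * (norm u)\<^sup>2"
  obtains G d where "bounded_clinear G" "\<forall>u. A (G u) = u" "\<forall>u. G (A u) = u"
    "d > 0" "\<forall>v. inner (G v) v \<ge> d * (norm v)\<^sup>2"
proof -
  have lin: "linear_operator (op_of A)"
    by (auto simp: linear_operator_def op_of_def single_valued_def clinear_simps[OF A])
  have "bounded_linear (\<lambda>x. A (fst x))"
    using bounded_linear_compose[OF bounded_clinear_linear[OF A] bounded_linear_fst] .
  then have "closed {x. A (fst x) = snd x}"
    by (intro closed_Collect_eq linear_continuous_on bounded_linear_snd)
  moreover have "op_of A = {x. A (fst x) = snd x}"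
    by (auto simp: op_of_def)
  ultimately have cl: "closed (op_of A)"
    by simp
  obtain G where G: "bounded_clinear G" "\<And>u f. (u, f) \<in> op_of A \<longleftrightarrow> u = G f"
  proof (rule coercive_graph_inverse[OF lin cl, where k = "1 / c"])
    show "norm u \<le> 1 / c * norm f" if "(u, f) \<in> op_of A" for u f
    proof (cases "u = 0")
      case False
      have "c * (norm u)\<^sup>2 \<le> norm (A u) * norm u"
        using acc[of u] norm_cauchy_schwarz[of "A u" u] by linarith
      then show ?thesis
        using False that c by (simp add: op_of_def power2_eq_square field_simps)
    qed (use c in simp)
    show "y = 0" if "\<And>u f. (u, f) \<in> op_of A \<Longrightarrow> inner f y = 0" for y
      using acc[of y] that[of y "A y"] c by (simp add: op_of_def mult_le_0_iff)
  qed auto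
  have AG: "A (G u) = u" and GA: "G (A u) = u" for u
    using G(2)[of "G u" u] G(2)[of u "A u"] by (auto simp: op_of_def)
  obtain K where K: "K > 0" "\<And>x. norm (A x) \<le> K * norm x"
    using bounded_clinear_bound[OF A] by metis
  have "inner (G v) v \<ge> c / K\<^sup>2 * (norm v)\<^sup>2" for v
  proof -
    have "(norm v)\<^sup>2 \<le> (K * norm (G v))\<^sup>2"
      using K(2)[of "G v"] AG by (intro power_mono) auto
    then have "c / K\<^sup>2 * (norm v)\<^sup>2 \<le> c / K\<^sup>2 * (K * norm (G v))\<^sup>2"
      using c by (intro mult_left_mono) auto
    also have "\<dots> = c * (norm (G v))\<^sup>2"
      using K(1) by (simp add: power_mult_distrib)
    also have "\<dots> \<le> inner (G v) v"
      using acc[of "G v"] AG by (simp add: inner_commute)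
    finally show ?thesis .
  qed
  moreover have "c / K\<^sup>2 > 0"
    using c K by simp
  ultimately show ?thesis
    using that G(1) AG GA by blast
qed


section \<open>Bisectors\<close>

text \<open>
  An inequality between real and imaginary part in place of arguments: it shows that bisectors are
  closed, and it is the form in which membership is checked below. The restriction
  \<open>\<omega> < \<pi>/2\<close> matters, since \<open>tan\<close> is meaningful as a slope only there.
\<close>

lemma bisector_eq:
  assumes "0 \<le> \<omega>" "\<omega> < pi / 2"
  shows "bisector \<omega> = {z. \<bar>Im z\<bar> \<le> tan \<omega> * \<bar>Re z\<bar>}"
proof -
  have right: "\<bar>Arg z\<bar> \<le> \<omega> \<longleftrightarrow> \<bar>Im z\<bar> \<le> tan \<omega> * Re z" if "Re z > 0" for z
  proof -
    have a: "Arg z = arctan (Im z / Re z)"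
      using that by (rule arg_conv_arctan)
    have "\<bar>Arg z\<bar> \<le> \<omega> \<longleftrightarrow> \<bar>Im z / Re z\<bar> \<le> tan \<omega>"
    proof -
      have w: "\<omega> = arctan (tan \<omega>)"
        using assms by (simp add: arctan_tan)
      have "\<bar>arctan x\<bar> \<le> arctan y \<longleftrightarrow> \<bar>x\<bar> \<le> y" for x y
        by (simp only: abs_le_iff arctan_minus[symmetric] arctan_le_iff)
      then show ?thesis
        using w a by metis
    qed
    also have "\<dots> \<longleftrightarrow> \<bar>Im z\<bar> \<le> tan \<omega> * Re z"
      using that by (simp add: abs_divide field_simps)
    finally show ?thesis .
  qed
  have left: "\<not> \<bar>Arg z\<bar> \<le> \<omega>" if "Re z \<le> 0" "z \<noteq> 0" for z
    using that assms Arg_Re_pos[of z] by auto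
  have "z \<in> bisector \<omega> \<longleftrightarrow> \<bar>Im z\<bar> \<le> tan \<omega> * \<bar>Re z\<bar>" for z
  proof (cases "z = 0")
    case False
    consider "Re z > 0" | "Re z < 0" | "Re z = 0"
      by linarith
    then show ?thesis
    proof cases
      case 1
      then show ?thesis
        using right[of z] left[of "-z"] False by (auto simp: bisector_def)
    next
      case 2
      then show ?thesis
        using right[of "-z"] left[of "z"] False by (auto simp: bisector_def)
    next
      case 3
      then show ?thesis
        using left[of "-z"] left[of "z"] False by (auto simp: bisector_def complex_eq_iff)
    qed
  qed (simp add: bisector_def)
  then show ?thesis
    by blast
qed

lemma closed_bisector:
  assumes "0 \<le> \<omega>" "\<omega> < pi / 2"
  shows "closed (bisector \<omega>)"
  unfolding bisector_eq[OF assms] by (intro closed_Collect_le continuous_intros)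

lemma zero_in_bisector: "0 \<in> bisector \<omega>"
  by (simp add: bisector_def)

lemma bisector_mono: "\<omega> \<le> \<omega>' \<Longrightarrow> bisector \<omega> \<subseteq> bisector \<omega>'"
  by (auto simp: bisector_def)

lemma infdist_bisector_pos:
  assumes "0 \<le> \<omega>" "\<omega> < pi / 2" "z \<notin> bisector \<omega>"
  shows "infdist z (bisector \<omega>) > 0"
  using closed_bisector[OF assms(1,2)] assms(3) zero_in_bisector[of \<omega>]
    infdist_nonneg[of z "bisector \<omega>"] in_closed_iff_infdist_zero[of "bisector \<omega>" z]
  by fastforce

lemma imaginary_notin_bisector:
  assumes "0 \<le> \<omega>" "\<omega> < pi / 2" "Re z = 0" "z \<noteq> 0"
  shows "z \<notin> bisector \<omega>"
  using assms by (auto simp: bisector_eq complex_eq_iff)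

text \<open>
  The bisector contains all real multiples of the conjugate of \<open>\<zeta>\<close>. The point \<open>p\<close> chosen in the
  proof is the orthogonal projection of \<open>z\<close> onto that real line; its distance to \<open>z\<close>
  is exactly the modulus of \<open>Im (z \<zeta>)\<close> divided by that of \<open>\<zeta>\<close>.
\<close>

lemma infdist_bisector_le_Im:
  assumes "0 \<le> \<omega>" "\<omega> < pi / 2" and \<zeta>: "Re \<zeta> > 0" "\<bar>Im \<zeta>\<bar> \<le> tan \<omega> * Re \<zeta>"
  shows "infdist z (bisector \<omega>) * Re \<zeta> \<le> \<bar>Im (z * \<zeta>)\<bar>"
proof -
  define p where "p = of_real (Re (z * \<zeta>) / (cmod \<zeta>)\<^sup>2) * cnj \<zeta>"
  have nz: "cmod \<zeta> > 0"
    using \<zeta>(1) by auto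
  have "p \<in> bisector \<omega>"
    using mult_left_mono[OF \<zeta>(2), of "\<bar>Re (z * \<zeta>) / (cmod \<zeta>)\<^sup>2\<bar>"] \<zeta>(1)
    by (simp add: bisector_eq[OF assms(1,2)] p_def abs_mult mult.left_commute)
  then have "infdist z (bisector \<omega>) \<le> dist z p"
    by (rule infdist_le)
  moreover have "(z - p) * \<zeta> = \<i> * Im (z * \<zeta>)"
  proof -
    have "p * \<zeta> = of_real (Re (z * \<zeta>) / (cmod \<zeta>)\<^sup>2) * of_real ((cmod \<zeta>)\<^sup>2)"
      unfolding complex_norm_square by (simp add: p_def mult.assoc mult.commute[of "cnj \<zeta>"])
    also have "\<dots> = Re (z * \<zeta>)"
      using nz by (simp only: of_real_mult[symmetric]) simp
    finally show ?thesis
      by (simp add: complex_eq_iff left_diff_distrib)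
  qed
  then have "cmod (z - p) * cmod \<zeta> = \<bar>Im (z * \<zeta>)\<bar>"
    by (metis norm_mult norm_ii mult_1 norm_of_real)
  moreover have "infdist z (bisector \<omega>) * Re \<zeta> \<le> infdist z (bisector \<omega>) * cmod \<zeta>"
    by (intro mult_left_mono complex_Re_le_cmod infdist_nonneg)
  ultimately show ?thesis
    using nz mult_right_mono[of "infdist z (bisector \<omega>)" "cmod (z - p)" "cmod \<zeta>"]
    by (simp add: dist_norm)
qed


section \<open>Resolvents\<close>

text \<open>
  The equation \<open>(z - T) u = f\<close> is written as \<open>(u, z u - f) \<in> T\<close>, which avoids unfolding sums, multiples
  and converses of graphs.
\<close>

definition has_resolvent :: "'a::complex_inner operator \<Rightarrow> complex \<Rightarrow> ('a \<Rightarrow> 'a) \<Rightarrow> bool" where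
  "has_resolvent T z R \<longleftrightarrow>
     bounded_clinear R \<and> (\<forall>f u. (u, z *\<^sub>C u - f) \<in> T \<longleftrightarrow> u = R f)"

lemma mem_resolvent_iff: "(f, u) \<in> resolvent T z \<longleftrightarrow> (u, z *\<^sub>C u - f) \<in> T"
proof -
  have "(f, u) \<in> resolvent T z \<longleftrightarrow> (\<exists>v. (u, v) \<in> T \<and> f = z *\<^sub>C u + (-1) *\<^sub>C v)"
    by (auto simp: resolvent_def op_add_def op_of_def op_scale_def)
  also have "\<dots> \<longleftrightarrow> (\<exists>v. (u, v) \<in> T \<and> v = z *\<^sub>C u - f)"
  proof -
    have "f = z *\<^sub>C u + (-1) *\<^sub>C v \<longleftrightarrow> v = z *\<^sub>C u - f" for v
      by (auto simp: eq_diff_eq diff_eq_eq add.commute)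
    then show ?thesis
      by simp
  qed
  finally show ?thesis
    by simp
qed

lemma resolvent_eq_op_of_iff:
  "resolvent T z = op_of R \<longleftrightarrow> (\<forall>f u. (u, z *\<^sub>C u - f) \<in> T \<longleftrightarrow> u = R f)"
  by (auto simp: set_eq_iff mem_resolvent_iff op_of_def)

lemma mem_resolvent_set_iff: "z \<in> resolvent_set T \<longleftrightarrow> (\<exists>R. has_resolvent T z R)"
  by (auto simp: resolvent_set_def has_resolvent_def resolvent_eq_op_of_iff)

lemma app_op_of [simp]: "app (op_of f) = f"
  by (rule ext) (simp add: app_def op_of_def)

lemma has_resolvent_app: "has_resolvent T z R \<Longrightarrow> app (resolvent T z) = R"
proof -
  assume "has_resolvent T z R"
  then have "resolvent T z = op_of R"
    by (simp add: has_resolvent_def resolvent_eq_op_of_iff)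
  then show ?thesis
    by simp
qed

lemma bisectorialI:
  assumes "linear_operator T" "0 \<le> \<omega>" "\<omega> < pi / 2"
    and "\<And>z. z \<notin> bisector \<omega> \<Longrightarrow>
      \<exists>R. has_resolvent T z R \<and> onorm R \<le> C / infdist z (bisector \<omega>)"
  shows "bisectorial T"
  unfolding bisectorial_def spectrum_def
proof (intro conjI exI allI impI)
  show "- resolvent_set T \<subseteq> bisector \<omega>"
    using assms(4) mem_resolvent_set_iff by blast
  show "onorm (app (resolvent T z)) \<le> C / infdist z (bisector \<omega>)" if "z \<notin> bisector \<omega>" for z
    using assms(4)[OF that] by (auto simp: has_resolvent_app)
qed (use assms in auto)

lemma bisectorialE:
  assumes "bisectorial T"
  obtains \<omega> C where "linear_operator T" "0 \<le> \<omega>" "\<omega> < pi / 2" "C \<ge> 0"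
    "\<And>z. z \<notin> bisector \<omega> \<Longrightarrow>
      \<exists>R. has_resolvent T z R \<and> onorm R \<le> C / infdist z (bisector \<omega>)"
proof -
  obtain \<omega> C where *: "linear_operator T" "0 \<le> \<omega>" "\<omega> < pi / 2" "- resolvent_set T \<subseteq> bisector \<omega>"
    and C: "\<And>z. z \<notin> bisector \<omega> \<Longrightarrow> onorm (app (resolvent T z)) \<le> C / infdist z (bisector \<omega>)"
    using assms unfolding bisectorial_def spectrum_def by blast
  show ?thesis
  proof (rule that[OF *(1-3), of "max C 0"])
    fix z
    assume z: "z \<notin> bisector \<omega>"
    then obtain R where R: "has_resolvent T z R"
      using *(4) mem_resolvent_set_iff by blast
    have "onorm R \<le> C / infdist z (bisector \<omega>)"
      using C[OF z] has_resolvent_app[OF R] by simp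
    also have "\<dots> \<le> max C 0 / infdist z (bisector \<omega>)"
      by (intro divide_right_mono infdist_nonneg) simp
    finally show "\<exists>R. has_resolvent T z R \<and> onorm R \<le> max C 0 / infdist z (bisector \<omega>)"
      using R by blast
  qed simp
qed

text \<open>
  The resolvent identity gives \<open>R z f - R \<mu> f = (\<mu> - z) R \<mu> (R z f)\<close>. When \<open>z\<close> is close to \<open>\<mu>\<close>, this
  bounds \<open>R z f\<close> in terms of \<open>R \<mu>\<close> alone, and a second use of the identity gives local Lipschitz continuity.
\<close>

lemma resolvent_continuous:
  assumes R: "\<And>z. z \<in> Z \<Longrightarrow> has_resolvent T z (R z)"
  shows "continuous_on Z (\<lambda>z. R z f)"
  unfolding continuous_on_def
proof
  fix \<mu>
  assume \<mu>: "\<mu> \<in> Z"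
  have R\<mu>: "bounded_clinear (R \<mu>)"
    using R[OF \<mu>] by (simp add: has_resolvent_def)
  obtain k where k: "k > 0" "\<And>f. norm (R \<mu> f) \<le> k * norm f"
    using bounded_clinear_bound[OF R\<mu>] by metis
  have bound: "norm (R z f - R \<mu> f) \<le> cmod (z - \<mu>) * (2 * k * k * norm f)"
    if z: "z \<in> Z" "cmod (z - \<mu>) * k \<le> 1 / 2" for z
  proof -
    define a where "a = R z f"
    have "(a, z *\<^sub>C a - f) \<in> T"
      using R[OF z(1)] by (simp add: has_resolvent_def a_def)
    moreover have "z *\<^sub>C a - f = \<mu> *\<^sub>C a - ((\<mu> - z) *\<^sub>C a + f)"
      by (simp add: algebra_simps)
    ultimately have "a = R \<mu> ((\<mu> - z) *\<^sub>C a + f)"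
      using R[OF \<mu>] unfolding has_resolvent_def by metis
    then have diff: "a - R \<mu> f = (\<mu> - z) *\<^sub>C R \<mu> a"
      by (metis add_diff_cancel_right' clinear_simps(1,4)[OF R\<mu>])
    then have d: "norm (a - R \<mu> f) \<le> cmod (z - \<mu>) * k * norm a"
      using mult_left_mono[OF k(2)[of a], of "cmod (z - \<mu>)"]
      by (simp add: norm_minus_commute mult.assoc)
    also have "\<dots> \<le> 1 / 2 * norm a"
      using z(2) by (intro mult_right_mono) auto
    finally have "norm a \<le> 2 * (k * norm f)"
      using norm_triangle_ineq2[of a "R \<mu> f"] k(2)[of f] by linarith
    then have "cmod (z - \<mu>) * k * norm a \<le> cmod (z - \<mu>) * k * (2 * (k * norm f))"
      using k(1) by (intro mult_left_mono) auto
    then show ?thesis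
      using d by (simp add: a_def algebra_simps)
  qed
  have "((\<lambda>z. R z f - R \<mu> f) \<longlongrightarrow> 0) (at \<mu> within Z)"
  proof (rule Lim_null_comparison)
    show "\<forall>\<^sub>F z in at \<mu> within Z. norm (R z f - R \<mu> f) \<le> cmod (z - \<mu>) * (2 * k * k * norm f)"
      unfolding eventually_at using k(1) bound
      by (intro exI[of _ "1 / (2 * k)"]) (auto simp: dist_norm field_simps)
    have "((\<lambda>z. cmod (z - \<mu>) * (2 * k * k * norm f)) \<longlongrightarrow> cmod (\<mu> - \<mu>) * (2 * k * k * norm f))
        (at \<mu> within Z)"
      by (intro tendsto_intros)
    then show "((\<lambda>z. cmod (z - \<mu>) * (2 * k * k * norm f)) \<longlongrightarrow> 0) (at \<mu> within Z)"
      by simp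
  qed
  then show "((\<lambda>z. R z f) \<longlongrightarrow> R \<mu> f) (at \<mu> within Z)"
    by (simp add: LIM_zero_iff)
qed

text \<open>
  By mutual annihilation, \<open>T1 (R2 f - f/z) = 0\<close>, since \<open>R2 f - f/z\<close> is \<open>1/z\<close> times the vector
  \<open>T2 (R2 f)\<close>. So \<open>T1\<close> acts on the proposed solution as on \<open>R1 f\<close>, and symmetrically for
  \<open>T2\<close>; adding the two gives existence. For uniqueness, if \<open>z e = T1 e + T2 e\<close>, then applying
  \<open>T1\<close> shows that \<open>T1 e\<close> is annihilated by \<open>z - T1\<close>, so \<open>T1 e = 0\<close>; likewise \<open>T2 e = 0\<close>.
\<close>

lemma has_resolvent_sum:
  assumes T1: "linear_operator T1" and T2: "linear_operator T2"
    and ann12: "\<And>u v. (u, v) \<in> T2 \<Longrightarrow> (v, 0) \<in> T1"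
    and ann21: "\<And>u v. (u, v) \<in> T1 \<Longrightarrow> (v, 0) \<in> T2"
    and R1: "has_resolvent T1 z R1" and R2: "has_resolvent T2 z R2" and z: "z \<noteq> 0"
  shows "has_resolvent (op_add T1 T2) z (\<lambda>f. R1 f + R2 f - (1 / z) *\<^sub>C f)"
proof -
  have b1: "bounded_clinear R1" and b2: "bounded_clinear R2"
    and r1: "\<And>f u. (u, z *\<^sub>C u - f) \<in> T1 \<longleftrightarrow> u = R1 f"
    and r2: "\<And>f u. (u, z *\<^sub>C u - f) \<in> T2 \<longleftrightarrow> u = R2 f"
    using R1 R2 unfolding has_resolvent_def by blast+
  have comb: "R1 f + R2 f - (1 / z) *\<^sub>C f = R1 f + (1 / z) *\<^sub>C (z *\<^sub>C R2 f - f)"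
    "R1 f + R2 f - (1 / z) *\<^sub>C f = R2 f + (1 / z) *\<^sub>C (z *\<^sub>C R1 f - f)" for f
    using z by (simp_all add: algebra_simps)
  have ex: "(R1 f + R2 f - (1 / z) *\<^sub>C f, z *\<^sub>C (R1 f + R2 f - (1 / z) *\<^sub>C f) - f) \<in> op_add T1 T2" for f
  proof -
    let ?u = "R1 f + R2 f - (1 / z) *\<^sub>C f"
    let ?v1 = "z *\<^sub>C R1 f - f" and ?v2 = "z *\<^sub>C R2 f - f"
    have m1: "(R1 f, ?v1) \<in> T1" and m2: "(R2 f, ?v2) \<in> T2"
      using r1 r2 by auto
    have n1: "(?v2, 0) \<in> T1" and n2: "(?v1, 0) \<in> T2"
      using ann12[OF m2] ann21[OF m1] .
    have "(R1 f + (1 / z) *\<^sub>C ?v2, ?v1 + (1 / z) *\<^sub>C 0) \<in> T1"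
      by (intro linear_operator_add[OF T1] linear_operator_scale[OF T1] m1 n1)
    then have "(?u, ?v1) \<in> T1"
      by (simp only: comb(1)[of f, symmetric] cvs.scale_zero_right add_0_right)
    moreover have "(R2 f + (1 / z) *\<^sub>C ?v1, ?v2 + (1 / z) *\<^sub>C 0) \<in> T2"
      by (intro linear_operator_add[OF T2] linear_operator_scale[OF T2] m2 n2)
    then have "(?u, ?v2) \<in> T2"
      by (simp only: comb(2)[of f, symmetric] cvs.scale_zero_right add_0_right)
    ultimately have "(?u, ?v1 + ?v2) \<in> op_add T1 T2"
      by (rule op_addI) simp
    moreover have "?v1 + ?v2 = z *\<^sub>C ?u - f"
      using z by (simp add: algebra_simps)
    ultimately show ?thesis
      by simp
  qed
  have "u = R1 f + R2 f - (1 / z) *\<^sub>C f" if u: "(u, z *\<^sub>C u - f) \<in> op_add T1 T2" for f u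
  proof -
    define e where "e = u - (R1 f + R2 f - (1 / z) *\<^sub>C f)"
    have "(e, z *\<^sub>C e) \<in> op_add T1 T2"
      using linear_operator_diff[OF linear_operator_op_add[OF T1 T2] u ex[of f]]
      by (simp add: e_def algebra_simps)
    then obtain v w where v: "(e, v) \<in> T1" and w: "(e, w) \<in> T2" and vw: "z *\<^sub>C e = v + w"
      by (rule op_addE)
    have "(z *\<^sub>C e - w, z *\<^sub>C v - 0) \<in> T1"
      by (intro linear_operator_diff[OF T1] linear_operator_scale[OF T1] v ann12[OF w])
    then have "(v, z *\<^sub>C v - 0) \<in> T1"
      by (simp only: vw add_diff_cancel_right')
    then have "v = R1 0"
      by (rule r1[THEN iffD1])
    have "(z *\<^sub>C e - v, z *\<^sub>C w - 0) \<in> T2"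
      by (intro linear_operator_diff[OF T2] linear_operator_scale[OF T2] w ann21[OF v])
    then have "(w, z *\<^sub>C w - 0) \<in> T2"
      by (simp only: vw add_diff_cancel_left')
    then have "w = R2 0"
      by (rule r2[THEN iffD1])
    then have "z *\<^sub>C e = 0"
      using vw \<open>v = R1 0\<close> by (simp add: clinear_simps(3)[OF b1] clinear_simps(3)[OF b2])
    then show ?thesis
      using z by (simp add: e_def)
  qed
  then show ?thesis
    unfolding has_resolvent_def
  proof (intro conjI allI iffI)
    show "bounded_clinear (\<lambda>f. R1 f + R2 f - (1 / z) *\<^sub>C f)"
      by (intro bounded_clinear_minus bounded_clinear_plus bounded_clinear_scale bounded_clinear_id b1 b2)
    show "(u, z *\<^sub>C u - f) \<in> op_add T1 T2" if "u = R1 f + R2 f - (1 / z) *\<^sub>C f" for f u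
      unfolding that by (rule ex)
  qed
qed

text \<open>
  The larger of the two angles works for the sum. The term \<open>1/z\<close> in the resolvent is harmless
  because the bisector contains \<open>0\<close>, so that the distance from \<open>z\<close> to it is at most the modulus of \<open>z\<close>.
\<close>

lemma bisectorial_sum:
  assumes T1: "bisectorial T1" and T2: "bisectorial T2"
    and ann12: "\<And>u v. (u, v) \<in> T2 \<Longrightarrow> (v, 0) \<in> T1"
    and ann21: "\<And>u v. (u, v) \<in> T1 \<Longrightarrow> (v, 0) \<in> T2"
  shows "bisectorial (op_add T1 T2)"
proof -
  obtain \<omega>1 C1 where l1: "linear_operator T1" and w1: "0 \<le> \<omega>1" "\<omega>1 < pi / 2" "C1 \<ge> 0"
    and R1: "\<And>z. z \<notin> bisector \<omega>1 \<Longrightarrow>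
      \<exists>R. has_resolvent T1 z R \<and> onorm R \<le> C1 / infdist z (bisector \<omega>1)"
    using bisectorialE[OF T1] by metis
  obtain \<omega>2 C2 where l2: "linear_operator T2" and w2: "0 \<le> \<omega>2" "\<omega>2 < pi / 2" "C2 \<ge> 0"
    and R2: "\<And>z. z \<notin> bisector \<omega>2 \<Longrightarrow>
      \<exists>R. has_resolvent T2 z R \<and> onorm R \<le> C2 / infdist z (bisector \<omega>2)"
    using bisectorialE[OF T2] by metis
  define \<omega> where "\<omega> = max \<omega>1 \<omega>2"
  have w: "0 \<le> \<omega>" "\<omega> < pi / 2" "\<omega>1 \<le> \<omega>" "\<omega>2 \<le> \<omega>"
    using w1 w2 by (auto simp: \<omega>_def)
  show ?thesis
  proof (rule bisectorialI[OF linear_operator_op_add[OF l1 l2] w(1,2), where C = "C1 + C2 + 1"])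
    fix z
    assume z: "z \<notin> bisector \<omega>"
    let ?d = "infdist z (bisector \<omega>)"
    have d: "?d > 0"
      using infdist_bisector_pos[OF w(1,2) z] .
    have z0: "z \<noteq> 0"
      using z zero_in_bisector by metis
    have ne: "bisector \<omega>' \<noteq> {}" for \<omega>'
      using zero_in_bisector by blast
    have dz: "?d \<le> cmod z"
      using infdist_le[OF zero_in_bisector, of z \<omega>] by simp
    have z1: "z \<notin> bisector \<omega>1" and z2: "z \<notin> bisector \<omega>2"
      using z bisector_mono w(3,4) by blast+
    have d1: "C1 / infdist z (bisector \<omega>1) \<le> C1 / ?d" and d2: "C2 / infdist z (bisector \<omega>2) \<le> C2 / ?d"
      using d w1(3) w2(3) infdist_mono[OF bisector_mono[OF w(3)] ne]
        infdist_mono[OF bisector_mono[OF w(4)] ne]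
      by (auto intro!: divide_left_mono mult_pos_pos infdist_bisector_pos w1 w2 z1 z2)
    obtain S1 where S1: "has_resolvent T1 z S1" "onorm S1 \<le> C1 / infdist z (bisector \<omega>1)"
      using R1[OF z1] by blast
    obtain S2 where S2: "has_resolvent T2 z S2" "onorm S2 \<le> C2 / infdist z (bisector \<omega>2)"
      using R2[OF z2] by blast
    have b1: "bounded_linear S1" and b2: "bounded_linear S2"
      using S1(1) S2(1) by (auto simp: has_resolvent_def bounded_clinear_def)
    let ?R = "\<lambda>f. S1 f + S2 f - (1 / z) *\<^sub>C f"
    have "onorm ?R \<le> (C1 + C2 + 1) / ?d"
    proof (rule onorm_bound)
      show "0 \<le> (C1 + C2 + 1) / ?d"
        using d w1(3) w2(3) by simp
      fix f
      have "norm (?R f) \<le> norm (S1 f) + norm (S2 f) + norm ((1 / z) *\<^sub>C f)"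
        by (intro order_trans[OF norm_triangle_ineq4] add_right_mono norm_triangle_ineq)
      also have "\<dots> \<le> onorm S1 * norm f + onorm S2 * norm f + 1 / cmod z * norm f"
        by (intro add_mono onorm b1 b2) (simp add: norm_divide)
      also have "\<dots> \<le> C1 / ?d * norm f + C2 / ?d * norm f + 1 / ?d * norm f"
        using S1(2) S2(2) d1 d2 dz d z0
        by (intro add_mono mult_right_mono divide_left_mono) (auto intro: mult_pos_pos)
      also have "\<dots> = (C1 + C2 + 1) / ?d * norm f"
        by (simp add: add_divide_distrib algebra_simps)
      finally show "norm (?R f) \<le> (C1 + C2 + 1) / ?d * norm f" .
    qed
    moreover have "has_resolvent (op_add T1 T2) z ?R"
      by (rule has_resolvent_sum[OF l1 l2 _ _ S1(1) S2(1) z0]) (use ann12 ann21 in blast)+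
    ultimately show "\<exists>R. has_resolvent (op_add T1 T2) z R \<and> onorm R \<le> (C1 + C2 + 1) / ?d"
      by blast
  qed
qed


section \<open>Quadratic estimates\<close>

text \<open>
  With \<open>\<mu> = \<i>/t\<close> one has \<open>1 + t\<^sup>2 T\<^sup>2 = t\<^sup>2 (\<mu> - T) (- \<mu> - T)\<close>, and the formula is the partial fraction
  decomposition of \<open>t x / (1 + t\<^sup>2 x\<^sup>2)\<close> with poles at \<open>\<mu>\<close> and \<open>- \<mu>\<close>. Since products of unbounded
  operators carry domains, the two inclusions of graphs are verified separately.
\<close>

lemma psi_op_eq_resolvents:
  assumes T: "linear_operator T" and t: "t > 0"
    and Rp: "has_resolvent T (\<i> / t) Rp" and Rm: "has_resolvent T (- \<i> / t) Rm"
  shows "app (psi_op T t) u = of_real (- 1 / (2 * t)) *\<^sub>C (Rp u + Rm u)"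
proof -
  define \<mu> c :: complex where "\<mu> = \<i> / t" and "c = of_real (t\<^sup>2)"
  have \<mu>: "- \<i> / t = - \<mu>"
    by (simp add: \<mu>_def)
  have c: "c * (\<mu> * \<mu>) = -1" "\<mu> * (c * \<mu>) = -1" "\<mu> * (\<mu> * c) = -1"
    using t by (simp_all add: \<mu>_def c_def power2_eq_square)
  have rp: "\<And>f u. (u, \<mu> *\<^sub>C u - f) \<in> T \<longleftrightarrow> u = Rp f"
    and rm: "\<And>f u. (u, (- \<mu>) *\<^sub>C u - f) \<in> T \<longleftrightarrow> u = Rm f"
    using Rp Rm \<mu> by (auto simp: has_resolvent_def \<mu>_def)
  note add = linear_operator_add[OF T] and scale = linear_operator_scale[OF T]
    and diff = linear_operator_diff[OF T]
  define X where "X = op_add (op_of id) (op_scale c (op_comp T T))"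
  have X: "(w, u) \<in> X \<longleftrightarrow> (\<exists>y y'. (w, y) \<in> T \<and> (y, y') \<in> T \<and> u = w + c *\<^sub>C y')" for w
    by (auto simp: X_def op_comp_def op_scale_def op_add_def op_of_def)
  have "psi_op T t = op_comp (op_scale (of_real t) T) (X\<inverse>)"
    by (simp only: psi_op_def X_def c_def)
  then have psi_X: "(u, v) \<in> psi_op T t \<longleftrightarrow> (\<exists>w x. (w, u) \<in> X \<and> (w, x) \<in> T \<and> v = of_real t *\<^sub>C x)" for v
    by (auto simp: op_comp_def op_scale_def)
  have psi: "(u, v) \<in> psi_op T t \<longleftrightarrow>
      (\<exists>w y y'. (w, y) \<in> T \<and> (y, y') \<in> T \<and> u = w + c *\<^sub>C y' \<and> v = of_real t *\<^sub>C y)" for v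
  proof
    assume "(u, v) \<in> psi_op T t"
    then obtain w x where wx: "(w, u) \<in> X" "(w, x) \<in> T" "v = of_real t *\<^sub>C x"
      unfolding psi_X by blast
    then obtain y y' where y: "(w, y) \<in> T" "(y, y') \<in> T" "u = w + c *\<^sub>C y'"
      unfolding X by blast
    have "x = y"
      using linear_operator_unique[OF T wx(2) y(1)] .
    then show "\<exists>w y y'. (w, y) \<in> T \<and> (y, y') \<in> T \<and> u = w + c *\<^sub>C y' \<and> v = of_real t *\<^sub>C y"
      using y wx(3) by (intro exI[of _ w] exI[of _ y] exI[of _ y']) simp
  next
    assume "\<exists>w y y'. (w, y) \<in> T \<and> (y, y') \<in> T \<and> u = w + c *\<^sub>C y' \<and> v = of_real t *\<^sub>C y"
    then obtain w y y' where y: "(w, y) \<in> T" "(y, y') \<in> T" "u = w + c *\<^sub>C y'" "v = of_real t *\<^sub>C y"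
      by (elim exE conjE)
    have "(w, u) \<in> X"
      unfolding X using y by (intro exI[of _ y] exI[of _ y']) simp
    then show "(u, v) \<in> psi_op T t"
      unfolding psi_X using y by (intro exI[of _ w] exI[of _ y]) simp
  qed
  have only: "v = of_real (- 1 / (2 * t)) *\<^sub>C (Rp u + Rm u)" if "(u, v) \<in> psi_op T t" for v
  proof -
    obtain w y y' where w: "(w, y) \<in> T" and y: "(y, y') \<in> T"
      and u: "u = w + c *\<^sub>C y'" and v: "v = of_real t *\<^sub>C y"
      using \<open>(u, v) \<in> psi_op T t\<close> unfolding psi by (elim exE conjE)
    have "c *\<^sub>C ((- \<mu>) *\<^sub>C w - y) = Rp u"
    proof (subst rp[symmetric])
      have "(c *\<^sub>C ((- \<mu>) *\<^sub>C w - y), c *\<^sub>C ((- \<mu>) *\<^sub>C y - y')) \<in> T"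
        by (intro scale diff w y)
      moreover have "c *\<^sub>C ((- \<mu>) *\<^sub>C y - y') = \<mu> *\<^sub>C c *\<^sub>C ((- \<mu>) *\<^sub>C w - y) - u"
        by (simp add: u c algebra_simps)
      ultimately show "(c *\<^sub>C ((- \<mu>) *\<^sub>C w - y), \<mu> *\<^sub>C c *\<^sub>C ((- \<mu>) *\<^sub>C w - y) - u) \<in> T"
        by simp
    qed
    moreover have "c *\<^sub>C (\<mu> *\<^sub>C w - y) = Rm u"
    proof (subst rm[symmetric])
      have "(c *\<^sub>C (\<mu> *\<^sub>C w - y), c *\<^sub>C (\<mu> *\<^sub>C y - y')) \<in> T"
        by (intro scale diff w y)
      moreover have "c *\<^sub>C (\<mu> *\<^sub>C y - y') = (- \<mu>) *\<^sub>C c *\<^sub>C (\<mu> *\<^sub>C w - y) - u"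
        by (simp add: u c algebra_simps)
      ultimately show "(c *\<^sub>C (\<mu> *\<^sub>C w - y), (- \<mu>) *\<^sub>C c *\<^sub>C (\<mu> *\<^sub>C w - y) - u) \<in> T"
        by simp
    qed
    ultimately have "Rp u + Rm u = c *\<^sub>C ((- \<mu>) *\<^sub>C w - y) + c *\<^sub>C (\<mu> *\<^sub>C w - y)"
      by simp
    also have "\<dots> = (- (c + c)) *\<^sub>C y"
      unfolding cvs.scale_minus_left cvs.scale_left_distrib by (simp add: algebra_simps)
    finally have "of_real (- 1 / (2 * t)) *\<^sub>C (Rp u + Rm u) = (of_real (- 1 / (2 * t)) * (- (c + c))) *\<^sub>C y"
      by (simp only: cvs.scale_scale)
    also have "of_real (- 1 / (2 * t)) * (- (c + c)) = of_real t"
      using t by (simp add: c_def power2_eq_square field_simps)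
    finally show ?thesis
      by (simp add: v)
  qed
  have "(u, of_real (- 1 / (2 * t)) *\<^sub>C (Rp u + Rm u)) \<in> psi_op T t"
  proof -
    \<comment> \<open>\<open>?w\<close> is \<open>(1 + t\<^sup>2 T\<^sup>2)\<inverse> u\<close> in partial fractions; \<open>?y\<close> and \<open>?y'\<close> are \<open>T ?w\<close> and \<open>T ?y\<close>\<close>
    let ?h = "\<mu> / 2"
    let ?w = "?h *\<^sub>C (Rp u - Rm u)" and ?y = "(?h * \<mu>) *\<^sub>C (Rp u + Rm u)"
    let ?y' = "(?h * \<mu>) *\<^sub>C ((\<mu> *\<^sub>C Rp u - u) + ((- \<mu>) *\<^sub>C Rm u - u))"
    have a: "(Rp u, \<mu> *\<^sub>C Rp u - u) \<in> T" and b: "(Rm u, (- \<mu>) *\<^sub>C Rm u - u) \<in> T"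
      using rp rm by auto
    have "(?w, ?h *\<^sub>C ((\<mu> *\<^sub>C Rp u - u) - ((- \<mu>) *\<^sub>C Rm u - u))) \<in> T"
      by (intro scale diff a b)
    then have w: "(?w, ?y) \<in> T"
      by (simp add: algebra_simps)
    have y: "(?y, ?y') \<in> T"
      by (intro scale add a b)
    have ch: "c * (?h * \<mu>) = - 1 / 2"
      using c(1) by (simp add: algebra_simps)
    have "c *\<^sub>C ?y' = (- 1 / 2) *\<^sub>C ((\<mu> *\<^sub>C Rp u - u) + ((- \<mu>) *\<^sub>C Rm u - u))"
      by (simp only: cvs.scale_scale ch)
    also have "\<dots> = (1 / 2 + 1 / 2) *\<^sub>C u - ?w"
      unfolding cvs.scale_left_distrib by (simp add: algebra_simps)
    finally have u: "u = ?w + c *\<^sub>C ?y'"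
      by simp
    have "of_real t * (?h * \<mu>) = of_real (- 1 / (2 * t))"
      using t by (simp add: \<mu>_def field_simps)
    then have "of_real (- 1 / (2 * t)) *\<^sub>C (Rp u + Rm u) = of_real t *\<^sub>C ?y"
      by (simp only: cvs.scale_scale)
    then show ?thesis
      unfolding psi using w y u by (intro exI[of _ ?w] exI[of _ ?y] exI[of _ ?y'] conjI)
  qed
  then show ?thesis
    unfolding app_def using only by (rule the_equality)
qed

lemma bisectorial_imaginary_resolvents:
  assumes "bisectorial T"
  shows "\<exists>R. \<forall>z. Re z = 0 \<and> z \<noteq> 0 \<longrightarrow> has_resolvent T z (R z)"
proof -
  obtain \<omega> where w: "0 \<le> \<omega>" "\<omega> < pi / 2"
    and ex: "\<And>z. z \<notin> bisector \<omega> \<Longrightarrow> \<exists>R. has_resolvent T z R"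
    using bisectorialE[OF assms] by metis
  then have "\<forall>z. \<exists>r. Re z = 0 \<and> z \<noteq> 0 \<longrightarrow> has_resolvent T z r"
    using imaginary_notin_bisector[OF w] by blast
  then show ?thesis
    by (rule choice)
qed

text \<open>
  Measurability is needed to split the integral over a sum, the integral of a nonmeasurable
  function being only superadditive; it comes from continuity of the resolvent along the imaginary axis.
\<close>

lemma psi_op_measurable:
  assumes T: "bisectorial T"
  shows "(\<lambda>t. ennreal ((norm (app (psi_op T t) u))\<^sup>2 / t) * indicator {0<..} t)
    \<in> borel_measurable lborel"
proof -
  obtain R where R: "\<And>z. Re z = 0 \<Longrightarrow> z \<noteq> 0 \<Longrightarrow> has_resolvent T z (R z)"
    using bisectorial_imaginary_resolvents[OF T] by blast
  have lin: "linear_operator T"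
    using T by (simp add: bisectorial_def)
  have cont: "continuous_on {z. Re z = 0 \<and> z \<noteq> 0} (\<lambda>z. R z u)"
    by (rule resolvent_continuous[where T = T]) (use R in blast)
  have "continuous_on {0<..} (\<lambda>t. R (\<i> / of_real t) u)"
    "continuous_on {0<..} (\<lambda>t. R (- \<i> / of_real t) u)"
    by (intro continuous_on_compose2[OF cont] continuous_intros; force)+
  then have cont_R: "continuous_on {0<..}
      (\<lambda>t. (cmod (of_real (- 1 / (2 * t))) * norm (R (\<i> / of_real t) u + R (- \<i> / of_real t) u))\<^sup>2 / t)"
    by (intro continuous_intros) auto
  have psi_R: "(norm (app (psi_op T t) u))\<^sup>2 / t =
      (cmod (of_real (- 1 / (2 * t))) * norm (R (\<i> / of_real t) u + R (- \<i> / of_real t) u))\<^sup>2 / t"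
    if "t \<in> {0<..}" for t
    using that psi_op_eq_resolvents[OF lin, of t "R (\<i> / of_real t)" "R (- \<i> / of_real t)"] R
    by (simp only: greaterThan_iff norm_scaleC) force
  have "continuous_on {0<..} (\<lambda>t. (norm (app (psi_op T t) u))\<^sup>2 / t)"
    by (rule continuous_on_cong[OF refl psi_R, THEN iffD2, OF _ cont_R])
  then have "(\<lambda>t. indicator {0<..} t *\<^sub>R ((norm (app (psi_op T t) u))\<^sup>2 / t)) \<in> borel_measurable borel"
    by (intro borel_measurable_continuous_on_indicator) auto
  then have "(\<lambda>t. ennreal (indicator {0<..} t *\<^sub>R ((norm (app (psi_op T t) u))\<^sup>2 / t)))
      \<in> borel_measurable lborel"
    by simp
  also have "(\<lambda>t. ennreal (indicator {0<..} t *\<^sub>R ((norm (app (psi_op T t) u))\<^sup>2 / t))) =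
      (\<lambda>t. ennreal ((norm (app (psi_op T t) u))\<^sup>2 / t) * indicator {0<..} t)"
    by (auto simp: indicator_def)
  finally show ?thesis .
qed

text \<open>
  The correction terms \<open>1/z\<close> of the two resolvents at \<open>z = \<i>/t\<close> and \<open>z = -\<i>/t\<close> have opposite signs.
\<close>

lemma psi_op_sum:
  assumes T1: "bisectorial T1" and T2: "bisectorial T2"
    and ann12: "\<And>u v. (u, v) \<in> T2 \<Longrightarrow> (v, 0) \<in> T1"
    and ann21: "\<And>u v. (u, v) \<in> T1 \<Longrightarrow> (v, 0) \<in> T2"
    and t: "t > 0"
  shows "app (psi_op (op_add T1 T2) t) u = app (psi_op T1 t) u + app (psi_op T2 t) u"
proof -
  obtain R1 where R1: "\<And>z. Re z = 0 \<Longrightarrow> z \<noteq> 0 \<Longrightarrow> has_resolvent T1 z (R1 z)"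
    using bisectorial_imaginary_resolvents[OF T1] by blast
  obtain R2 where R2: "\<And>z. Re z = 0 \<Longrightarrow> z \<noteq> 0 \<Longrightarrow> has_resolvent T2 z (R2 z)"
    using bisectorial_imaginary_resolvents[OF T2] by blast
  have l1: "linear_operator T1" and l2: "linear_operator T2"
    using T1 T2 by (simp_all add: bisectorial_def)
  have R: "has_resolvent (op_add T1 T2) z (\<lambda>f. R1 z f + R2 z f - (1 / z) *\<^sub>C f)"
    if "Re z = 0" "z \<noteq> 0" for z
    by (rule has_resolvent_sum[OF l1 l2 _ _ R1[OF that] R2[OF that] that(2)])
      (use ann12 ann21 in blast)+
  have nz: "Re (\<i> / of_real t) = 0" "Re (- \<i> / of_real t) = 0"
    "\<i> / of_real t \<noteq> 0" "- \<i> / of_real t \<noteq> 0"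
    using t by auto
  have inv: "1 / (- \<i> / of_real t) = - (1 / (\<i> / of_real t))"
    by simp
  let ?c = "of_real (- 1 / (2 * t)) :: complex"
  have "app (psi_op (op_add T1 T2) t) u =
      ?c *\<^sub>C ((R1 (\<i> / t) u + R2 (\<i> / t) u - (1 / (\<i> / t)) *\<^sub>C u)
        + (R1 (- \<i> / t) u + R2 (- \<i> / t) u - (1 / (- \<i> / t)) *\<^sub>C u))"
    by (rule psi_op_eq_resolvents[OF linear_operator_op_add[OF l1 l2] t R R]) (use nz in auto)
  also have "\<dots> = ?c *\<^sub>C ((R1 (\<i> / t) u + R1 (- \<i> / t) u) + (R2 (\<i> / t) u + R2 (- \<i> / t) u))"
    unfolding inv cvs.scale_minus_left by (rule arg_cong[where f = "scaleC ?c"]) (simp only: algebra_simps, simp)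
  also have "\<dots> = app (psi_op T1 t) u + app (psi_op T2 t) u"
    unfolding psi_op_eq_resolvents[OF l1 t R1[OF nz(1,3)] R1[OF nz(2,4)]]
      psi_op_eq_resolvents[OF l2 t R2[OF nz(1,3)] R2[OF nz(2,4)]]
    by (rule scaleC_add_right)
  finally show ?thesis .
qed

lemma quadratic_estimates_sum:
  fixes T1 T2 :: "'a::complex_hilbert_space operator"
  assumes T1: "bisectorial T1" and T2: "bisectorial T2"
    and ann12: "\<And>u v. (u, v) \<in> T2 \<Longrightarrow> (v, 0) \<in> T1"
    and ann21: "\<And>u v. (u, v) \<in> T1 \<Longrightarrow> (v, 0) \<in> T2"
    and Q1: "quadratic_estimates T1" and Q2: "quadratic_estimates T2"
  shows "quadratic_estimates (op_add T1 T2)"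
proof -
  define q where "q T u = (\<lambda>t. ennreal ((norm (app (psi_op T t) u))\<^sup>2 / t) * indicator {0<..} t)"
    for T :: "'a operator" and u
  obtain C1 where C1: "\<And>u. (\<integral>\<^sup>+ t. q T1 u t \<partial>lborel) \<le> ennreal (C1 * (norm u)\<^sup>2)"
    using Q1 unfolding quadratic_estimates_def q_def by blast
  obtain C2 where C2: "\<And>u. (\<integral>\<^sup>+ t. q T2 u t \<partial>lborel) \<le> ennreal (C2 * (norm u)\<^sup>2)"
    using Q2 unfolding quadratic_estimates_def q_def by blast
  have meas: "q T1 u \<in> borel_measurable lborel" "q T2 u \<in> borel_measurable lborel" for u
    unfolding q_def by (intro psi_op_measurable T1 T2)+
  have twice: "ennreal (2 * x + 2 * y) = 2 * ennreal x + 2 * ennreal y" if "x \<ge> 0" "y \<ge> 0" for x y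
    using that by (simp add: ennreal_mult)
  have pointwise: "q (op_add T1 T2) u t \<le> 2 * q T1 u t + 2 * q T2 u t" for u t
  proof (cases "t > 0")
    case True
    define a b where "a = app (psi_op T1 t) u" and "b = app (psi_op T2 t) u"
    have ab: "app (psi_op (op_add T1 T2) t) u = a + b"
      unfolding a_def b_def by (rule psi_op_sum[OF T1 T2 _ _ True]) (use ann12 ann21 in blast)+
    have "(norm (a + b))\<^sup>2 \<le> (norm a + norm b)\<^sup>2"
      by (intro power_mono norm_triangle_ineq) simp
    also have "\<dots> \<le> 2 * (norm a)\<^sup>2 + 2 * (norm b)\<^sup>2"
      using sum_squares_bound[of "norm a" "norm b"] by (simp add: power2_sum)
    finally have "(norm (a + b))\<^sup>2 / t \<le> 2 * ((norm a)\<^sup>2 / t) + 2 * ((norm b)\<^sup>2 / t)"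
      using True by (simp add: field_simps)
    then have "ennreal ((norm (a + b))\<^sup>2 / t) \<le> ennreal (2 * ((norm a)\<^sup>2 / t) + 2 * ((norm b)\<^sup>2 / t))"
      by (rule ennreal_leI)
    also have "\<dots> = 2 * ennreal ((norm a)\<^sup>2 / t) + 2 * ennreal ((norm b)\<^sup>2 / t)"
      by (rule twice) (use True in auto)
    finally show ?thesis
      using True by (simp add: q_def ab a_def[symmetric] b_def[symmetric])
  qed (simp add: q_def)
  have "(\<integral>\<^sup>+ t. q (op_add T1 T2) u t \<partial>lborel)
      \<le> ennreal ((2 * max C1 0 + 2 * max C2 0) * (norm u)\<^sup>2)" for u
  proof -
    have "(\<integral>\<^sup>+ t. q (op_add T1 T2) u t \<partial>lborel)
        \<le> (\<integral>\<^sup>+ t. 2 * q T1 u t + 2 * q T2 u t \<partial>lborel)"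
      by (intro nn_integral_mono pointwise)
    also have "\<dots> = 2 * (\<integral>\<^sup>+ t. q T1 u t \<partial>lborel) + 2 * (\<integral>\<^sup>+ t. q T2 u t \<partial>lborel)"
      using meas[of u] by (simp add: nn_integral_add nn_integral_cmult)
    also have "\<dots> \<le> 2 * ennreal (max C1 0 * (norm u)\<^sup>2) + 2 * ennreal (max C2 0 * (norm u)\<^sup>2)"
      by (intro add_mono mult_left_mono order_trans[OF C1] order_trans[OF C2] ennreal_leI
          mult_right_mono) auto
    also have "\<dots> = ennreal ((2 * max C1 0 + 2 * max C2 0) * (norm u)\<^sup>2)"
      by (simp add: ennreal_plus ennreal_mult distrib_right mult.assoc)
    finally show ?thesis .
  qed
  then show ?thesis
    unfolding quadratic_estimates_def q_def by blast
qed


section \<open>Perturbing a self-adjoint operator by a multiplier\<close>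

lemma self_adjoint_linear: "self_adjoint D \<Longrightarrow> linear_operator D"
  by (simp add: self_adjoint_def)

text \<open>
  Testing the real part against \<open>x\<close> and \<open>- \<i> x\<close> recovers the complex identity that defines the adjoint.
\<close>

lemma self_adjoint_mem_iff:
  assumes "self_adjoint D"
  shows "(v, w) \<in> D \<longleftrightarrow> (\<forall>(x, y)\<in>D. inner y v = inner x w)"
proof -
  have eq: "(v, w) \<in> D \<longleftrightarrow> (\<forall>x y. (x, y) \<in> D \<longrightarrow> cinner y v = cinner x w)"
    using assms unfolding self_adjoint_def adjoint_op_def by blast
  have "cinner y v = cinner x w" if "\<forall>(x, y)\<in>D. inner y v = inner x w" "(x, y) \<in> D" for x y
  proof -
    have "((- \<i>) *\<^sub>C x, (- \<i>) *\<^sub>C y) \<in> D"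
      using linear_operator_scale[OF self_adjoint_linear[OF assms] that(2)] .
    then have "inner ((- \<i>) *\<^sub>C y) v = inner ((- \<i>) *\<^sub>C x) w"
      using that(1) by blast
    moreover have "inner y v = inner x w"
      using that by blast
    ultimately show ?thesis
      unfolding inner_scaleC_left by (simp add: complex_eq_iff Re_cinner Im_cinner)
  qed
  moreover have "inner y v = inner x w" if "cinner y v = cinner x w" for x y
    using that Re_cinner by metis
  ultimately show ?thesis
    unfolding eq by blast
qed

lemma self_adjoint_symmetric:
  assumes "self_adjoint D" "(u, v) \<in> D" "(x, y) \<in> D"
  shows "inner y u = inner x v"
  using self_adjoint_mem_iff[OF assms(1), of u v] assms(2,3) by blast

lemma self_adjoint_Im_zero:
  assumes D: "self_adjoint D" and uv: "(u, v) \<in> D"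
  shows "Im (cinner v u) = 0"
proof -
  have "inner ((- \<i>) *\<^sub>C v) u = inner ((- \<i>) *\<^sub>C u) v"
    by (rule self_adjoint_symmetric[OF D uv linear_operator_scale[OF self_adjoint_linear[OF D] uv]])
  then have "Im (cinner v u) = Im (cinner u v)"
    unfolding inner_scaleC_left by (simp add: Im_cinner)
  then show ?thesis
    using arg_cong[OF cinner_commute[of u v], of Im] by simp
qed

lemma closed_self_adjoint:
  assumes "self_adjoint D"
  shows "closed D"
proof -
  have "D = (\<Inter>p\<in>D. {x. inner (snd p) (fst x) = inner (fst p) (snd x)})"
    using self_adjoint_mem_iff[OF assms] by fastforce
  moreover have "closed (\<Inter>p\<in>D. {x. inner (snd p) (fst x) = inner (fst p) (snd x)})"
    by (intro closed_INT ballI closed_Collect_eq continuous_intros)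
  ultimately show ?thesis
    by simp
qed

text \<open>
  The choice of \<open>\<omega>\<close> puts \<open>\<zeta> = (G u, u)\<close> into the sector of half-angle \<open>\<omega>\<close>, because the modulus of
  \<open>Im \<zeta>\<close> is at most \<open>K\<close> times the squared norm of \<open>u\<close>, hence at most \<open>K/d\<close> times \<open>Re \<zeta>\<close>. As \<open>(D u, u)\<close> is
  real, the imaginary part of \<open>((z G - D) u, u)\<close> is that of \<open>z \<zeta>\<close>, which yields the lower bound \<open>est\<close>.
  If \<open>y\<close> is orthogonal to the range of \<open>z G - D\<close>, then self-adjointness puts \<open>y\<close> into the
  domain of \<open>D\<close>, and \<open>est\<close> applied to \<open>y\<close> itself gives \<open>y = 0\<close>.
\<close>

lemma pencil_inverse:
  fixes D :: "'a::complex_hilbert_space operator"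
  assumes D: "self_adjoint D" and G: "bounded_clinear G" and d: "d > 0"
    and acc: "\<And>u. inner (G u) u \<ge> d * (norm u)\<^sup>2"
    and K: "\<And>u. norm (G u) \<le> K * norm u"
    and \<omega>: "\<omega> = arctan (K / d)" "0 \<le> \<omega>" "\<omega> < pi / 2" and z: "z \<notin> bisector \<omega>"
  obtains R where "bounded_clinear R" "\<forall>f. norm (R f) \<le> 1 / (infdist z (bisector \<omega>) * d) * norm f"
    "\<forall>u f. (u, z *\<^sub>C G u - f) \<in> D \<longleftrightarrow> u = R f"
proof -
  let ?m = "infdist z (bisector \<omega>)"
  have m: "?m > 0"
    using infdist_bisector_pos[OF \<omega>(2,3) z] .
  note lin = self_adjoint_linear[OF D]
  define L where "L = {(u, f). (u, z *\<^sub>C G u - f) \<in> D}"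
  have L_iff: "(u, f) \<in> L \<longleftrightarrow> (u, z *\<^sub>C G u - f) \<in> D" for u f
    by (simp add: L_def)
  have lin_L: "linear_operator L"
    unfolding linear_operator_def
  proof (intro conjI allI impI)
    show "single_valued L"
    proof (rule single_valuedI)
      fix u f g
      assume "(u, f) \<in> L" "(u, g) \<in> L"
      then have "z *\<^sub>C G u - f = z *\<^sub>C G u - g"
        unfolding L_iff by (rule linear_operator_unique[OF lin])
      then show "f = g"
        by simp
    qed
    show "(0, 0) \<in> L"
      using linear_operator_zero[OF lin] by (simp add: L_iff clinear_simps[OF G])
    show "(u + u', f + f') \<in> L" if "(u, f) \<in> L" "(u', f') \<in> L" for u f u' f'
    proof -
      have "z *\<^sub>C G (u + u') - (f + f') = (z *\<^sub>C G u - f) + (z *\<^sub>C G u' - f')"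
        by (simp add: clinear_simps[OF G] scaleC_add_right)
      then show ?thesis
        using linear_operator_add[OF lin that[unfolded L_iff]] by (simp only: L_iff)
    qed
    show "(c *\<^sub>C u, c *\<^sub>C f) \<in> L" if "(u, f) \<in> L" for c u f
    proof -
      have "z *\<^sub>C G (c *\<^sub>C u) - c *\<^sub>C f = c *\<^sub>C (z *\<^sub>C G u - f)"
        by (simp add: clinear_simps[OF G] cvs.scale_right_diff_distrib mult.commute)
      then show ?thesis
        using linear_operator_scale[OF lin that[unfolded L_iff], of c] by (simp only: L_iff)
    qed
  qed
  have closed_L: "closed L"
  proof -
    have zG: "bounded_linear (\<lambda>x. z *\<^sub>C G (fst x))"
      by (rule bounded_linear_compose[OF bounded_clinear_linear[OF bounded_clinear_scale[OF G]]
            bounded_linear_fst])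
    have "closed ((\<lambda>x. (fst x, z *\<^sub>C G (fst x) - snd x)) -` D)"
      by (intro closed_vimage closed_self_adjoint[OF D] continuous_on_Pair continuous_on_diff
          linear_continuous_on zG bounded_linear_fst bounded_linear_snd)
    moreover have "L = (\<lambda>x. (fst x, z *\<^sub>C G (fst x) - snd x)) -` D"
      by (auto simp: L_def)
    ultimately show ?thesis
      by simp
  qed
  have est: "?m * d * (norm u)\<^sup>2 \<le> \<bar>Im (cinner f u)\<bar>" if "(u, f) \<in> L" for u f
  proof (cases "u = 0")
    case False
    let ?\<zeta> = "cinner (G u) u"
    have re: "Re ?\<zeta> \<ge> d * (norm u)\<^sup>2"
      using acc[of u] by (simp add: Re_cinner)
    then have pos: "Re ?\<zeta> > 0"
      using d False by (meson less_le_trans mult_pos_pos zero_less_norm_iff zero_less_power)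
    have "K \<ge> 0"
      using order_trans[OF norm_ge_zero K[of u]] False by (simp add: zero_le_mult_iff)
    have "\<bar>Im ?\<zeta>\<bar> \<le> K * (norm u)\<^sup>2"
      using abs_Im_cinner_le[of "G u" u] mult_right_mono[OF K[of u], of "norm u"]
      by (simp add: power2_eq_square mult.assoc)
    also have "\<dots> = K / d * (d * (norm u)\<^sup>2)"
      using d by simp
    also have "\<dots> \<le> K / d * Re ?\<zeta>"
      using re d \<open>K \<ge> 0\<close> by (intro mult_left_mono) auto
    finally have im: "\<bar>Im ?\<zeta>\<bar> \<le> tan \<omega> * Re ?\<zeta>"
      by (simp add: \<omega>(1) tan_arctan)
    have "Im (cinner (z *\<^sub>C G u - f) u) = 0"
      using self_adjoint_Im_zero[OF D] that by (simp add: L_iff)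
    then have "Im (cinner f u) = Im (z * ?\<zeta>)"
      by (simp add: cinner_diff_left cinner_scaleC_left)
    then have "?m * Re ?\<zeta> \<le> \<bar>Im (cinner f u)\<bar>"
      using infdist_bisector_le_Im[OF \<omega>(2,3) pos im, of z] by simp
    moreover have "?m * (d * (norm u)\<^sup>2) \<le> ?m * Re ?\<zeta>"
      using re m by (intro mult_left_mono) auto
    ultimately show ?thesis
      by (simp add: mult.assoc)
  qed simp
  have below: "norm u \<le> 1 / (?m * d) * norm f" if "(u, f) \<in> L" for u f
  proof (cases "u = 0")
    case False
    have "?m * d * (norm u)\<^sup>2 \<le> norm f * norm u"
      using est[OF that] abs_Im_cinner_le[of f u] by linarith
    then have "?m * d * norm u \<le> norm f"
      using False by (simp add: power2_eq_square mult.assoc[symmetric])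
    then show ?thesis
      using m d by (simp add: field_simps)
  qed (use m d in simp)
  have dense: "y = 0" if y: "\<And>u f. (u, f) \<in> L \<Longrightarrow> inner f y = 0" for y
  proof -
    have "bounded_linear (\<lambda>v. inner (z *\<^sub>C G v) y)"
      by (rule bounded_linear_compose[OF bounded_linear_inner_left
            bounded_clinear_linear[OF bounded_clinear_scale[OF G]]])
    \<comment> \<open>\<open>Z\<close> is the adjoint of \<open>z G\<close> applied to \<open>y\<close>\<close>
    then obtain Z where Z: "\<And>v. inner (z *\<^sub>C G v) y = inner v Z"
      using riesz_representation by blast
    have "inner w y = inner v Z" if "(v, w) \<in> D" for v w
    proof -
      have "inner (z *\<^sub>C G v - w) y = 0"
        by (rule y[of v]) (use that in \<open>simp add: L_iff\<close>)
      then show ?thesis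
        by (simp add: inner_diff_left Z)
    qed
    then have "(y, Z) \<in> D"
      by (intro iffD2[OF self_adjoint_mem_iff[OF D]]) blast
    then have yL: "(y, z *\<^sub>C G y - Z) \<in> L"
      by (simp add: L_iff)
    have "inner ((- \<i>) *\<^sub>C (z *\<^sub>C G y - Z)) y = 0"
      by (rule y[OF linear_operator_scale[OF lin_L yL]])
    then have "Im (cinner (z *\<^sub>C G y - Z) y) = 0"
      unfolding inner_scaleC_left Im_cinner by simp
    then have "?m * d * (norm y)\<^sup>2 \<le> 0"
      using est[OF yL] by simp
    then show ?thesis
      using m d by (simp add: mult_le_0_iff)
  qed
  show ?thesis
  proof (rule coercive_graph_inverse[OF lin_L closed_L, where k = "1 / (?m * d)"])
    fix R
    assume R: "bounded_clinear R" "\<And>f. norm (R f) \<le> 1 / (?m * d) * norm f"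
      "\<And>u f. (u, f) \<in> L \<longleftrightarrow> u = R f"
    show ?thesis
      by (rule that) (use R in \<open>auto simp: L_iff\<close>)
  qed (fact below dense)+
qed

text \<open>
  The hypothesis on \<open>T\<close> says \<open>T = M\<inverse> G\<inverse> D M\<close>, stated without \<open>G\<inverse>\<close>. The equation \<open>(z - T) u = f\<close>
  becomes \<open>(z G - D) (M u) = G (M f)\<close>, so its solution operator is that of the pencil
  composed with the bounded operators \<open>N = M\<inverse>\<close>, \<open>G\<close> and \<open>M\<close>.
\<close>

lemma bisectorial_similar:
  fixes D :: "'a::complex_hilbert_space operator"
  assumes D: "self_adjoint D" and G: "bounded_clinear G" and d: "d > 0"
    and acc: "\<And>u. inner (G u) u \<ge> d * (norm u)\<^sup>2"
    and M: "bounded_clinear M" and N: "bounded_clinear N"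
    and MN: "\<And>x. M (N x) = x" and NM: "\<And>x. N (M x) = x"
    and inj: "\<And>x. G x = 0 \<Longrightarrow> x = 0"
    and T: "\<And>u v. (u, v) \<in> T \<longleftrightarrow> (M u, G (M v)) \<in> D"
  shows "bisectorial T"
proof -
  note lin = self_adjoint_linear[OF D] and cl = clinear_simps[OF M] clinear_simps[OF G]
  obtain K where K: "K > 0" "\<And>x. norm (G x) \<le> K * norm x"
    using bounded_clinear_bound[OF G] by metis
  obtain kM where kM: "kM > 0" "\<And>x. norm (M x) \<le> kM * norm x"
    using bounded_clinear_bound[OF M] by metis
  obtain kN where kN: "kN > 0" "\<And>x. norm (N x) \<le> kN * norm x"
    using bounded_clinear_bound[OF N] by metis
  define \<omega> where "\<omega> = arctan (K / d)"
  have \<omega>: "0 \<le> \<omega>" "\<omega> < pi / 2"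
    using K(1) d arctan_bounded[of "K / d"] by (auto simp: \<omega>_def zero_le_arctan_iff)
  have "linear_operator T"
    unfolding linear_operator_def
  proof (intro conjI allI impI)
    show "single_valued T"
    proof (rule single_valuedI)
      fix u v w
      assume "(u, v) \<in> T" "(u, w) \<in> T"
      then have "G (M v) = G (M w)"
        unfolding T by (rule linear_operator_unique[OF lin])
      then have "G (M (v - w)) = 0"
        by (simp add: cl)
      then have "M (v - w) = 0"
        by (rule inj)
      then show "v = w"
        using NM[of "v - w"] by (simp add: clinear_simps[OF N])
    qed
    show "(0, 0) \<in> T"
      using linear_operator_zero[OF lin] by (simp add: T cl)
    show "(u + u', v + v') \<in> T" if "(u, v) \<in> T" "(u', v') \<in> T" for u v u' v'
      using linear_operator_add[OF lin that[unfolded T]] by (simp add: T cl)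
    show "(c *\<^sub>C u, c *\<^sub>C v) \<in> T" if "(u, v) \<in> T" for c u v
      using linear_operator_scale[OF lin that[unfolded T], of c] by (simp add: T cl)
  qed
  then show ?thesis
  proof (rule bisectorialI[OF _ \<omega>, where C = "kN * K * kM / d"])
    fix z
    assume z: "z \<notin> bisector \<omega>"
    let ?m = "infdist z (bisector \<omega>)"
    have m: "?m > 0"
      using infdist_bisector_pos[OF \<omega> z] .
    obtain R where R: "bounded_clinear R" "\<forall>f. norm (R f) \<le> 1 / (?m * d) * norm f"
      "\<forall>u f. (u, z *\<^sub>C G u - f) \<in> D \<longleftrightarrow> u = R f"
      by (rule pencil_inverse[OF D G d acc K(2) \<omega>_def \<omega> z])
    note R = R(1) R(2-)[rule_format]
    let ?S = "\<lambda>f. N (R (G (M f)))"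
    have "(u, z *\<^sub>C u - f) \<in> T \<longleftrightarrow> u = ?S f" for u f
    proof -
      have "(u, z *\<^sub>C u - f) \<in> T \<longleftrightarrow> M u = R (G (M f))"
        unfolding T R(3)[symmetric] by (simp add: cl)
      also have "\<dots> \<longleftrightarrow> u = ?S f"
        using MN NM by metis
      finally show ?thesis .
    qed
    moreover have "bounded_clinear ?S"
      by (intro bounded_clinear_compose[OF N] bounded_clinear_compose[OF R(1)]
          bounded_clinear_compose[OF G] M)
    ultimately have "has_resolvent T z ?S"
      unfolding has_resolvent_def by simp
    moreover have "onorm ?S \<le> kN * K * kM / d / ?m"
    proof (rule onorm_bound)
      show "0 \<le> kN * K * kM / d / ?m"
        using kN(1) K(1) kM(1) d m by simp
      fix f
      have "norm (?S f) \<le> kN * norm (R (G (M f)))"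
        by (rule kN)
      also have "\<dots> \<le> kN * (1 / (?m * d) * norm (G (M f)))"
        using kN(1) by (intro mult_left_mono R) auto
      also have "\<dots> \<le> kN * (1 / (?m * d) * (K * norm (M f)))"
        using kN(1) m d by (intro mult_left_mono K) auto
      also have "\<dots> \<le> kN * (1 / (?m * d) * (K * (kM * norm f)))"
        using kN(1) m d K(1) by (intro mult_left_mono kM) auto
      also have "\<dots> = kN * K * kM / d / ?m * norm f"
        by (simp add: ac_simps)
      finally show "norm (?S f) \<le> kN * K * kM / d / ?m * norm f" .
    qed
    ultimately show "\<exists>R. has_resolvent T z R \<and> onorm R \<le> kN * K * kM / d / ?m"
      by blast
  qed
qed

section \<open>Multiplicative perturbations that are accretive on the range\<close>

text \<open>
  A vector orthogonal to the range of a self-adjoint operator lies in its null space, by the definition of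
  the adjoint; this is why \<open>x - P x\<close> is in the null space.
\<close>

lemma projection_onto_closure_range:
  fixes D :: "'a::complex_hilbert_space operator"
  assumes D: "self_adjoint D"
  obtains P where "bounded_clinear P" "\<forall>x. P x \<in> closure (Range D)" "\<forall>x. (x - P x, 0) \<in> D"
    "\<forall>x y. inner (x - P x) (P y) = 0" "\<forall>x. P (P x) = P x"
    "\<forall>w\<in>Range D. P w = w"
proof -
  note lin = self_adjoint_linear[OF D]
  let ?S = "closure (Range D)"
  have add: "x + y \<in> ?S" if xy: "x \<in> ?S" "y \<in> ?S" for x y
  proof -
    obtain a where a: "\<And>n. a n \<in> Range D" "a \<longlonglongrightarrow> x"
      using xy(1) unfolding closure_sequential by blast
    obtain b where b: "\<And>n. b n \<in> Range D" "b \<longlonglongrightarrow> y"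
      using xy(2) unfolding closure_sequential by blast
    have "a n + b n \<in> Range D" for n
      using a(1)[of n] b(1)[of n] linear_operator_add[OF lin] by blast
    moreover have "(\<lambda>n. a n + b n) \<longlonglongrightarrow> x + y"
      by (intro tendsto_intros a b)
    ultimately show ?thesis
      unfolding closure_sequential by (intro exI[of _ "\<lambda>n. a n + b n"]) simp
  qed
  have scale: "c *\<^sub>C x \<in> ?S" if x: "x \<in> ?S" for c x
  proof -
    obtain a where a: "\<And>n. a n \<in> Range D" "a \<longlonglongrightarrow> x"
      using x unfolding closure_sequential by blast
    have "c *\<^sub>C a n \<in> Range D" for n
      using a(1)[of n] linear_operator_scale[OF lin] by blast
    moreover have "(\<lambda>n. c *\<^sub>C a n) \<longlonglongrightarrow> c *\<^sub>C x"
      by (rule bounded_linear.tendsto[OF bounded_linear_scaleC a(2)])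
    ultimately show ?thesis
      unfolding closure_sequential by (intro exI[of _ "\<lambda>n. c *\<^sub>C a n"]) simp
  qed
  have "0 \<in> ?S"
    using linear_operator_zero[OF lin] closure_subset[of "Range D"] by blast
  then have "subspace ?S"
    using add scale by (rule subspace_scaleC_I)
  then obtain P where P: "bounded_clinear P" "\<forall>x. P x \<in> ?S"
    "\<forall>x. \<forall>s\<in>?S. inner (x - P x) s = 0"
    "\<forall>x\<in>?S. P x = x"
    by (rule orthogonal_projection_clinear[OF closed_closure _ scale])
  note P = P(1) P(2-)[rule_format]
  have null: "(x - P x, 0) \<in> D" for x
    unfolding self_adjoint_mem_iff[OF D]
  proof (intro ballI, clarify)
    fix u w
    assume "(u, w) \<in> D"
    then have "w \<in> ?S"
      using closure_subset[of "Range D"] by blast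
    then show "inner w (x - P x) = inner u 0"
      using P(3)[of w x] by (simp add: inner_commute)
  qed
  have P_range: "P w = w" if "(u, w) \<in> D" for u w
    using that closure_subset[of "Range D"] by (intro P(4)) blast
  show ?thesis
  proof (rule that[OF P(1)])
    show "\<forall>x. P (P x) = P x" "\<forall>x y. inner (x - P x) (P y) = 0"
      using P(4)[OF P(2)] P(3)[OF P(2)] by blast+
    show "\<forall>w\<in>Range D. P w = w"
      using P_range by blast
  qed (use P(2) null in blast)+
qed

lemma accretive_on_closure:
  assumes B: "bounded_clinear B"
    and acc: "\<And>w. w \<in> S \<Longrightarrow> inner (B w) w \<ge> \<delta> * (norm w)\<^sup>2"
    and w: "w \<in> closure S"
  shows "inner (B w) w \<ge> \<delta> * (norm w)\<^sup>2"
proof -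
  have "closed {w. \<delta> * (norm w)\<^sup>2 \<le> inner (B w) w}"
    by (intro closed_Collect_le continuous_on_inner continuous_on_mult continuous_on_power
        continuous_on_norm continuous_on_const continuous_on_id
        linear_continuous_on bounded_clinear_linear[OF B])
  then have "closure S \<subseteq> {w. \<delta> * (norm w)\<^sup>2 \<le> inner (B w) w}"
    using acc by (intro closure_minimal) auto
  then show ?thesis
    using w by blast
qed

text \<open>
  Here \<open>G\<close> is the inverse of \<open>A = P B P + (1 - P)\<close>. By orthogonality \<open>Re (A x, x)\<close> splits into
  \<open>Re (B (P x), P x)\<close> and the squared norm of \<open>x - P x\<close>, so \<open>A\<close> is accretive with constant \<open>min \<delta> 1\<close>.
\<close>

lemma accretive_extension:
  fixes D :: "'a::complex_hilbert_space operator"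
  assumes D: "self_adjoint D" and B: "bounded_clinear B" and \<delta>: "\<delta> > 0"
    and acc: "\<forall>w\<in>Range D. inner (B w) w \<ge> \<delta> * (norm w)\<^sup>2"
  obtains P G d where "bounded_clinear P" "\<forall>x. (x - P x, 0) \<in> D" "\<forall>x. P (P x) = P x"
    "\<forall>w\<in>Range D. P w = w"
    "bounded_clinear G" "\<forall>x. P (B (P (G x))) + (G x - P (G x)) = x"
    "\<forall>x. G (P (B (P x)) + (x - P x)) = x"
    "d > 0" "\<forall>v. inner (G v) v \<ge> d * (norm v)\<^sup>2"
proof -
  obtain P where P: "bounded_clinear P" "\<forall>x. P x \<in> closure (Range D)" "\<forall>x. (x - P x, 0) \<in> D"
    "\<forall>x y. inner (x - P x) (P y) = 0" "\<forall>x. P (P x) = P x"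
    "\<forall>w\<in>Range D. P w = w"
    by (rule projection_onto_closure_range[OF D])
  note PC = P(2)[rule_format] and PO = P(4)[rule_format]
  let ?A = "\<lambda>x. P (B (P x)) + (x - P x)"
  have "bounded_clinear ?A"
    by (intro bounded_clinear_plus bounded_clinear_minus bounded_clinear_id
        bounded_clinear_compose[OF P(1)] bounded_clinear_compose[OF B] P(1))
  moreover have "min \<delta> 1 > 0"
    using \<delta> by simp
  moreover have "min \<delta> 1 * (norm x)\<^sup>2 \<le> inner (?A x) x" for x
  proof -
    have "\<delta> * (norm (P x))\<^sup>2 \<le> inner (B (P x)) (P x)"
      by (rule accretive_on_closure[OF B _ PC]) (use acc in blast)
    moreover have "inner (P (B (P x))) x = inner (B (P x)) (P x)"
      using PO[of "B (P x)" x] PO[of x "B (P x)"]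
      by (simp add: inner_diff inner_commute)
    moreover have "inner (x - P x) x = (norm (x - P x))\<^sup>2"
      using PO[of x x] unfolding power2_norm_eq_inner by (simp add: inner_diff_right)
    moreover have "(norm x)\<^sup>2 = (norm (P x))\<^sup>2 + (norm (x - P x))\<^sup>2"
      using PO[of x x] unfolding power2_norm_eq_inner
      by (simp add: inner_diff inner_commute)
    moreover have "min \<delta> 1 * (norm (P x))\<^sup>2 \<le> \<delta> * (norm (P x))\<^sup>2"
      "min \<delta> 1 * (norm (x - P x))\<^sup>2 \<le> 1 * (norm (x - P x))\<^sup>2"
      by (intro mult_right_mono; simp)+
    ultimately show ?thesis
      by (simp add: inner_add_left distrib_left)
  qed
  ultimately obtain G d where G: "bounded_clinear G" "\<forall>u. ?A (G u) = u" "\<forall>u. G (?A u) = u"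
    "d > 0" "\<forall>v. inner (G v) v \<ge> d * (norm v)\<^sup>2"
    by (rule accretive_inverse)
  show ?thesis
    by (rule that[OF P(1,3,5,6) G])
qed

lemma mem_multiplier_left: "(u, v) \<in> op_comp (op_of B) D \<longleftrightarrow> (\<exists>w. (u, w) \<in> D \<and> v = B w)"
  unfolding op_comp_def op_of_def by blast

lemma mem_multiplier_right: "(u, v) \<in> op_comp D (op_of B) \<longleftrightarrow> (B u, v) \<in> D"
  unfolding op_comp_def op_of_def by blast

text \<open>
  Both operators are similar to \<open>A D\<close> with \<open>A = G\<inverse>\<close>. In block form with respect to \<open>P\<close>, the factorization
  \<open>B P = V A P\<close> with \<open>V = 1 + (1 - P) B P G\<close> gives \<open>B D = V A D V\<inverse>\<close>: the factor \<open>V\<inverse>\<close> changes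
  its argument only by vectors in the null space of \<open>D\<close>, which \<open>D\<close> does not see. So \<open>M = V\<inverse>\<close> for
  \<open>B D\<close>. For \<open>D B\<close>, write \<open>P B = P A W\<close> with \<open>W = 1 + G P B (1 - P)\<close>. As \<open>W\<close> is the identity on
  the range of \<open>D\<close>, this gives \<open>D B = W\<inverse> (D A) W = (A W)\<inverse> (A D) (A W)\<close>, so \<open>M = A W\<close>, which
  simplifies to \<open>P B + (1 - P)\<close>.
\<close>

lemma
  fixes D :: "'a::complex_hilbert_space operator"
  assumes D: "self_adjoint D" and B: "bounded_clinear B" and \<delta>: "\<delta> > 0"
    and acc: "\<forall>w\<in>Range D. inner (B w) w \<ge> \<delta> * (norm w)\<^sup>2"
  shows bisectorial_multiplier_left: "bisectorial (op_comp (op_of B) D)"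
    and bisectorial_multiplier_right: "bisectorial (op_comp D (op_of B))"
proof -
  obtain P G d where P: "bounded_clinear P" and "\<forall>x. (x - P x, 0) \<in> D" and "\<forall>x. P (P x) = P x"
    and "\<forall>w\<in>Range D. P w = w" and G: "bounded_clinear G"
    and "\<forall>x. P (B (P (G x))) + (G x - P (G x)) = x" and "\<forall>x. G (P (B (P x)) + (x - P x)) = x"
    and d: "d > 0" and "\<forall>v. inner (G v) v \<ge> d * (norm v)\<^sup>2"
    by (rule accretive_extension[OF D B \<delta> acc])
  then have null: "\<And>x. (x - P x, 0) \<in> D" and PP: "\<And>x. P (P x) = P x"
    and P_range: "\<And>u w. (u, w) \<in> D \<Longrightarrow> P w = w"
    and AG: "\<And>x. P (B (P (G x))) + (G x - P (G x)) = x"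
    and GA: "\<And>x. G (P (B (P x)) + (x - P x)) = x"
    and accG: "\<And>v. inner (G v) v \<ge> d * (norm v)\<^sup>2"
    by blast+
  note Pl = clinear_simps[OF P] and Gl = clinear_simps[OF G] and Bl = clinear_simps[OF B]
  note diff = linear_operator_diff[OF self_adjoint_linear[OF D]]
    and add = linear_operator_add[OF self_adjoint_linear[OF D]]
  have G_inj: "x = 0" if "G x = 0" for x
    using AG[of x] that by (simp add: Pl Bl)
  have PQ: "P (x - P x) = 0" for x
    by (simp add: Pl PP)
  have G_null: "G (x - P x) = x - P x" for x
    using GA[of "x - P x"] by (simp only: PQ Pl(3) Bl(3) diff_zero add_0)
  have G_range: "P (G (P x)) = G (P x)" for x
  proof -
    have "P (B (P (G (P x)))) = P x"
      using arg_cong[OF AG[of "P x"], of P] by (simp add: Pl PP)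
    then show ?thesis
      using AG[of "P x"] by simp
  qed
  have PG: "P (G x) = G (P x)" for x
  proof -
    have "G x = G (P x) + (x - P x)"
      using G_null[of x] by (simp add: Gl algebra_simps)
    then show ?thesis
      using G_range[of x] PQ[of x] by (simp add: Pl)
  qed
  \<comment> \<open>\<open>D\<close> does not see components in its null space\<close>
  have shift: "(x + (y - P y), w) \<in> D \<longleftrightarrow> (x, w) \<in> D" for x y w
    using add[of x w "y - P y" 0] diff[of "x + (y - P y)" w "y - P y" 0] null[of y] by auto
  show "bisectorial (op_comp (op_of B) D)"
  proof (rule bisectorial_similar[OF D G d accG _ _ _ _ G_inj])
    let ?b = "\<lambda>x. B (P (G x))"
    let ?M = "\<lambda>x. x - (?b x - P (?b x))" and ?N = "\<lambda>x. x + (?b x - P (?b x))"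
    have b: "bounded_clinear ?b"
      by (intro bounded_clinear_compose[OF B] bounded_clinear_compose[OF P] G)
    have c: "bounded_clinear (\<lambda>x. ?b x - P (?b x))"
      by (rule bounded_clinear_minus[OF b bounded_clinear_compose[OF P b]])
    show "bounded_clinear ?M" "bounded_clinear ?N"
      by (rule bounded_clinear_minus[OF bounded_clinear_id c]
          bounded_clinear_plus[OF bounded_clinear_id c])+
    have b_null: "?b (y - P y) = 0" for y
      by (simp only: G_null PQ Bl(3))
    show "?M (?N x) = x" "?N (?M x) = x" for x
      unfolding bounded_clinear_add[OF b] bounded_clinear_diff[OF b, of x] b_null by simp_all
    show "(u, v) \<in> op_comp (op_of B) D \<longleftrightarrow> (?M u, G (?M v)) \<in> D" for u v
    proof -
      have "(?M u, w) \<in> D \<longleftrightarrow> (u, w) \<in> D" for w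
        using shift[of "?M u" "?b u" w] by (simp only: diff_add_cancel)
      moreover have GM: "G (?M v) = G v - (?b v - P (?b v))"
        by (simp only: bounded_clinear_diff[OF G, of v] G_null)
      moreover have "(u, v) \<in> op_comp (op_of B) D \<longleftrightarrow> (u, G v - (?b v - P (?b v))) \<in> D"
      proof
        assume "(u, v) \<in> op_comp (op_of B) D"
        then obtain w where w: "(u, w) \<in> D" "v = B w"
          unfolding mem_multiplier_left by blast
        have Pw: "P w = w"
          using P_range[OF w(1)] .
        have "G v = w + (v - P v)"
          using GA[of "w + (v - P v)"] by (simp add: Pl PP Pw w(2))
        moreover from this have "?b v = v"
          by (simp add: Pl PP Pw w(2))
        ultimately show "(u, G v - (?b v - P (?b v))) \<in> D"
          using w(1) by simp
      next
        assume R: "(u, G v - (?b v - P (?b v))) \<in> D"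
        define b y where "b = ?b v" and "y = G v - (b - P b)"
        have y: "(u, y) \<in> D"
          using R by (simp only: b_def y_def)
        have Py: "P (G v) = y"
          using P_range[OF y] by (simp add: y_def Pl PP)
        have By: "B y = b"
          by (simp only: b_def Py)
        have "P b + (G v - y) = v"
          using AG[of v] by (simp only: Py By)
        then have "v = B y"
          unfolding By by (simp add: y_def)
        then show "(u, v) \<in> op_comp (op_of B) D"
          unfolding mem_multiplier_left using y by blast
      qed
      ultimately show ?thesis
        by simp
    qed
  qed
  show "bisectorial (op_comp D (op_of B))"
  proof (rule bisectorial_similar[OF D G d accG _ _ _ _ G_inj])
    let ?h = "\<lambda>y. G (P (B (G y - P (G y))))"
    let ?M = "\<lambda>x. P (B x) + (x - P x)" and ?N = "\<lambda>y. G y - ?h y"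
    show M: "bounded_clinear ?M"
      by (intro bounded_clinear_plus bounded_clinear_minus bounded_clinear_id
          bounded_clinear_compose[OF P] B P)
    show "bounded_clinear ?N"
      by (intro bounded_clinear_minus bounded_clinear_compose[OF G] bounded_clinear_compose[OF P]
          bounded_clinear_compose[OF B] P G)
    show MN: "?M (?N y) = y" for y
    proof -
      define k h where "k = P (B (G y - P (G y)))" and "h = G k"
      have Ph: "P h = h"
        unfolding h_def k_def by (rule G_range)
      have PBh: "P (B h) = k"
        using AG[of k] unfolding h_def[symmetric] by (simp add: Ph)
      have "?M (G y - h) = P (B (G y)) - k + (G y - P (G y))"
        by (simp add: Pl Bl Ph PBh)
      also have "\<dots> = P (B (P (G y))) + (G y - P (G y))"
        by (simp add: k_def Pl Bl)
      also have "\<dots> = y"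
        by (rule AG)
      finally show ?thesis
        by (simp only: h_def k_def)
    qed
    have M_inj: "x = 0" if "?M x = 0" for x
    proof -
      have "P (?M x) = P (B x)"
        by (simp add: Pl PP)
      then have "P (B x) = 0"
        by (simp only: that Pl(3))
      then have x: "P x = x"
        using that by simp
      have "P (B (P x)) + (x - P x) = 0"
        using that by (simp only: x)
      then show ?thesis
        using GA[of x] by (simp only: Gl(3))
    qed
    show "?N (?M x) = x" for x
    proof -
      have "?M (?N (?M x) - x) = ?M (?N (?M x)) - ?M x"
        by (rule bounded_clinear_diff[OF M])
      also have "\<dots> = 0"
        by (rule eq_iff_diff_eq_0[THEN iffD1, OF MN])
      finally have "?N (?M x) - x = 0"
        by (rule M_inj)
      then show ?thesis
        by (rule eq_iff_diff_eq_0[THEN iffD2])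
    qed
    show "(u, v) \<in> op_comp D (op_of B) \<longleftrightarrow> (?M u, G (?M v)) \<in> D" for u v
    proof -
      have M_u: "?M u = B u + ((u - B u) - P (u - B u))"
        by (simp add: Pl)
      have "(?M u, w) \<in> D \<longleftrightarrow> (B u, w) \<in> D" for w
        unfolding M_u by (rule shift)
      moreover have "(u, v) \<in> op_comp D (op_of B) \<longleftrightarrow> (B u, v) \<in> D"
        by (rule mem_multiplier_right)
      moreover have "(B u, v) \<in> D \<longleftrightarrow> (B u, G (?M v)) \<in> D"
      proof -
        have eq: "G (?M v) = v" if "P v = v"
          using GA[of v] that by simp
        have "P v = v" if y: "(B u, G (?M v)) \<in> D"
        proof -
          have "P (G (?M v)) = G (?M v)"
            using P_range[OF y] .
          then have "?M v = P (B (G (?M v)))"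
            using AG[of "?M v"] by simp
          then have "P (?M v) = ?M v"
            using PP by metis
          then show ?thesis
            by (simp add: Pl PP)
        qed
        then show ?thesis
          using eq P_range by metis
      qed
      ultimately show ?thesis
        by simp
    qed
  qed
qed

lemma app_eq: "linear_operator T \<Longrightarrow> (u, v) \<in> T \<Longrightarrow> app T u = v"
  unfolding app_def using linear_operator_unique[of T u] by blast

theorem proposition10p2:
  fixes D1 D2 :: "'a::complex_hilbert_space operator"
    and B1 B2 :: "'a \<Rightarrow> 'a"
    and \<delta>1 \<delta>2 :: real
  assumes "self_adjoint D1" and "self_adjoint D2"
    and "bounded_clinear B1" and "bounded_clinear B2"
    and "\<delta>1 > 0" and "\<delta>2 > 0"
    and "\<forall>u \<in> Domain D1. Re (cinner (B1 (app D1 u)) (app D1 u)) \<ge> \<delta>1 * (norm (app D1 u))\<^sup>2"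
    and "\<forall>u \<in> Domain D2. Re (cinner (B2 (app D2 u)) (app D2 u)) \<ge> \<delta>2 * (norm (app D2 u))\<^sup>2"
    and "Range D1 \<subseteq> null_space D2" and "Range D2 \<subseteq> null_space D1"
    and "(B2 \<circ> B1) ` Range D1 \<subseteq> null_space D2"
  shows "bisectorial (op_add (op_comp (op_of B1) D1) (op_comp D2 (op_of B2))) \<and>
    (quadratic_estimates (op_comp (op_of B1) D1) \<and>
     quadratic_estimates (op_comp D2 (op_of B2)) \<longrightarrow>
     quadratic_estimates (op_add (op_comp (op_of B1) D1) (op_comp D2 (op_of B2))))"
proof -
  let ?T1 = "op_comp (op_of B1) D1" and ?T2 = "op_comp D2 (op_of B2)"
  have acc1: "\<forall>w\<in>Range D1. inner (B1 w) w \<ge> \<delta>1 * (norm w)\<^sup>2"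
    using assms(7) app_eq[OF self_adjoint_linear[OF assms(1)]] by (fastforce simp: Re_cinner)
  have acc2: "\<forall>w\<in>Range D2. inner (B2 w) w \<ge> \<delta>2 * (norm w)\<^sup>2"
    using assms(8) app_eq[OF self_adjoint_linear[OF assms(2)]] by (fastforce simp: Re_cinner)
  have T1: "bisectorial ?T1"
    by (rule bisectorial_multiplier_left[OF assms(1,3,5) acc1])
  have T2: "bisectorial ?T2"
    by (rule bisectorial_multiplier_right[OF assms(2,4,6) acc2])
  have ann12: "(v, 0) \<in> ?T1" if "(u, v) \<in> ?T2" for u v
  proof -
    have "(v, 0) \<in> D1"
      using that assms(10) unfolding mem_multiplier_right null_space_def by blast
    moreover have "B1 0 = 0"
      using bounded_clinear_zero[OF assms(3)] .
    ultimately show ?thesis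
      unfolding mem_multiplier_left by (intro exI[of _ 0]) simp
  qed
  have ann21: "(v, 0) \<in> ?T2" if uv: "(u, v) \<in> ?T1" for u v
  proof -
    obtain w where "(u, w) \<in> D1" "v = B1 w"
      using uv unfolding mem_multiplier_left by blast
    then have "(B2 v, 0) \<in> D2"
      using assms(11) by (auto simp: null_space_def)
    then show ?thesis
      unfolding mem_multiplier_right .
  qed
  show ?thesis
    using bisectorial_sum[OF T1 T2] quadratic_estimates_sum[OF T1 T2] ann12 ann21 by blast
qed

end
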